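(* Let $s$ and $d$ be relatively prime positive integers. The number of self-conjugate $(s,s+d,s+2d,s+3d)$-core partitions is \[ \sum_{i=0}^{\lfloor s/4\rfloor}\binom{\frac{s+d-1}{2}-i}{\frac{s-1}{2}-2i} \binom{\frac{s+d-1}{2}-i}{i}\qquad\text{if $d$ is even,} \] and \[ \sum_{i=0}^{\lfloor s/2 \rfloor}\binom{\lfloor \frac{s+d-1}{2}\rfloor-\lfloor \frac{i}{2} \rfloor}{\lfloor \frac{s}{2} \rfloor-i}\binom{\lfloor \frac{s+d}{2} \rfloor-\lfloor \frac{i+1}{2} \rfloor}{\lfloor \frac{i}{2} \rfloor}\qquad\text{if $d$ is odd.} \]
   Context: A partition is a finite (possibly empty) non-increasing sequence of positive integers, identified with its Young diagram. The hook length of a box is the number of boxes to its right in the same row plus the number of boxes below it in the same column plus $1$. A partition is an $s$-core if no box has hook length $s$, and an $(s_1,\dots,s_q)$-core if it is an $s_i$-core for every $i$. A partition is self-conjugate if its Young diagram is invariant under reflection in the main diagonal. *)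

theory Defs
  imports Main
begin

definition is_partition :: "nat list \<Rightarrow> bool" where
  "is_partition p \<longleftrightarrow> sorted_wrt (\<ge>) p \<and> (\<forall>k\<in>set p. 0 < k)"

text \<open>Boxes are pairs (row, column), both counted from 0 (English convention).\<close>
definition young_diagram :: "nat list \<Rightarrow> (nat \<times> nat) set" where
  "young_diagram p = {(i, j). i < length p \<and> j < p ! i}"

definition hook_length :: "nat list \<Rightarrow> nat \<times> nat \<Rightarrow> nat" where
  "hook_length p = (\<lambda>(i, j).
     card {j'. j < j' \<and> (i, j') \<in> young_diagram p} +
     card {i'. i < i' \<and> (i', j) \<in> young_diagram p} + 1)"

definition is_core :: "nat \<Rightarrow> nat list \<Rightarrow> bool" where
  "is_core s p \<longleftrightarrow> (\<forall>b\<in>young_diagram p. hook_length p b \<noteq> s)"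

definition is_multicore :: "nat list \<Rightarrow> nat list \<Rightarrow> bool" where
  "is_multicore ss p \<longleftrightarrow> (\<forall>s\<in>set ss. is_core s p)"

definition self_conjugate :: "nat list \<Rightarrow> bool" where
  "self_conjugate p \<longleftrightarrow> prod.swap ` young_diagram p = young_diagram p"

definition self_conjugate_core_partitions :: "nat list \<Rightarrow> nat list set" where
  "self_conjugate_core_partitions ss =
     {p. is_partition p \<and> self_conjugate p \<and> is_multicore ss p}"

end

theory Submission
  imports Defs "HOL-Library.Infinite_Set"
begin

text \<open>
  A self-conjugate partition with rows \<open>\<lambda>\<^sub>0 \<ge> \<lambda>\<^sub>1 \<ge> \<dots>\<close> is encoded by the set of odd numbers
  \<open>2 (\<lambda>\<^sub>i - i) - 1\<close>. This set contains exactly one of \<open>y\<close>, \<open>- y\<close> for every odd \<open>y\<close>, and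
  the hook length of the box \<open>(i, j)\<close> is half the sum of the \<open>i\<close>-th and the \<open>j\<close>-th element;
  so being a \<open>t\<close>-core means that the set is closed under subtraction of \<open>2 t\<close>.
  Since \<open>s\<close> and \<open>d\<close> are coprime, every odd number is \<open>(2 j - c) d + (2 t - 1) s\<close> for some
  \<open>(j, t)\<close>, unique up to \<open>(j, t) \<mapsto> (j + s, t - d)\<close>, where \<open>c\<close> is 1 or 0 as \<open>s\<close> is even or odd.
  In these coordinates a closed set is the region \<open>t \<le> h j\<close> below a function \<open>h\<close> that is
  quasiperiodic (\<open>h (j + s) = h j - d\<close>), odd about \<open>c / 2\<close>, and satisfies
  \<open>h j \<le> h (j - k) + 1\<close> for \<open>k = 1, 2, 3\<close>. In terms of \<open>b j = 1 - h j + h (j - 1)\<close>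
  this says that one, two, three consecutive values of \<open>b\<close> sum to at least 0, 1, 2.
  As \<open>b\<close> is periodic and symmetric about two axes, half a period suffices, and what
  remains is a count of words of fixed length and sum accepted by a three-state automaton, with
  boundary conditions that depend on the parities of \<open>s\<close> and \<open>d\<close>. The counts and the
  binomial sums satisfy the same linear recurrence, with generating function
  \<open>1 / (1 - y (1 + x) - x\<^sup>2 y\<^sup>2 (1 + x))\<close>.
\<close>

section \<open>Self-conjugate partitions as sets of odd integers\<close>

text \<open>Padding by zero rows makes \<open>beta\<close> an infinite sequence, so that its range
  can contain one of \<open>y\<close>, \<open>- y\<close> for every odd \<open>y\<close>.\<close>

definition row :: "nat list \<Rightarrow> nat \<Rightarrow> nat" where
  "row p i = (if i < length p then p ! i else 0)"

definition beta :: "nat list \<Rightarrow> nat \<Rightarrow> int" where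
  "beta p i = 2 * int (row p i) - 2 * int i - 1"

text \<open>The upper bound allows the elements to be listed in decreasing order; the symmetry makes
  that list infinite.\<close>

definition symmetric_closed_sets :: "nat list \<Rightarrow> int set set" where
  "symmetric_closed_sets ts = {B. (\<forall>y\<in>B. odd y) \<and> (\<forall>y. odd y \<longrightarrow> (y \<in> B \<longleftrightarrow> - y \<notin> B)) \<and>
     (\<exists>M. \<forall>y\<in>B. y \<le> M) \<and> (\<forall>t\<in>set ts. \<forall>y\<in>B. y - 2 * int t \<in> B)}"

lemma young_diagram_iff: "(i, j) \<in> young_diagram p \<longleftrightarrow> j < row p i"
  by (auto simp: young_diagram_def row_def)

lemma row_antimono: "is_partition p \<Longrightarrow> i \<le> j \<Longrightarrow> row p j \<le> row p i"
  unfolding is_partition_def row_def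
  by (cases "i = j") (auto simp: sorted_wrt_iff_nth_less)

lemma row_pos_iff: "is_partition p \<Longrightarrow> 0 < row p i \<longleftrightarrow> i < length p"
  by (auto simp: is_partition_def row_def)

lemma partition_eqI:
  assumes "is_partition p" "is_partition p'" "row p = row p'"
  shows "p = p'"
proof (rule nth_equalityI)
  have "i < length p \<longleftrightarrow> i < length p'" for i
    using assms row_pos_iff by metis
  thus len: "length p = length p'"
    by (metis linorder_neqE_nat order_less_irrefl)
  show "p ! i = p' ! i" if "i < length p" for i
    using fun_cong[OF assms(3), of i] that len by (simp add: row_def)
qed

lemma self_conjugate_iff: "self_conjugate p \<longleftrightarrow> (\<forall>i j. j < row p i \<longleftrightarrow> i < row p j)"
proof -
  have "self_conjugate p \<longleftrightarrow> (\<forall>i j. (i, j) \<in> young_diagram p \<longleftrightarrow> (j, i) \<in> young_diagram p)"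
    unfolding self_conjugate_def set_eq_iff split_paired_All pair_in_swap_image by blast
  thus ?thesis by (simp add: young_diagram_iff)
qed

text \<open>By self-conjugacy column \<open>j\<close> is as long as row \<open>j\<close>, so the arm
  is \<open>row p i - j - 1\<close> and the leg is \<open>row p j - i - 1\<close>.\<close>

lemma hook_length_self_conjugate:
  assumes "self_conjugate p" "j < row p i"
  shows "2 * int (hook_length p (i, j)) = beta p i + beta p j"
proof -
  have sym: "\<And>i j. j < row p i \<longleftrightarrow> i < row p j" using assms(1) by (simp add: self_conjugate_iff)
  have "{j'. j < j' \<and> (i, j') \<in> young_diagram p} = {Suc j..<row p i}"
    by (auto simp: young_diagram_iff)
  moreover have "{i'. i < i' \<and> (i', j) \<in> young_diagram p} = {Suc i..<row p j}"
    by (auto simp: young_diagram_iff sym[of j])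
  ultimately have "hook_length p (i, j) = (row p i - Suc j) + (row p j - Suc i) + 1"
    by (simp add: hook_length_def)
  moreover have "i < row p j" using assms(2) sym by simp
  ultimately show ?thesis using assms(2) by (simp add: beta_def)
qed

text \<open>Outside the diagram both \<open>row p i \<le> j\<close> and
  \<open>row p j \<le> i\<close>, which makes the sum at most -2. So every positive sum comes from a
  box and is twice its hook length.\<close>

lemma is_core_iff_beta:
  assumes "self_conjugate p" "0 < t"
  shows "is_core t p \<longleftrightarrow> (\<forall>i j. beta p i + beta p j \<noteq> 2 * int t)"
proof
  assume core: "is_core t p"
  show "\<forall>i j. beta p i + beta p j \<noteq> 2 * int t"
  proof (intro allI notI)
    fix i j assume eq: "beta p i + beta p j = 2 * int t"
    have "j < row p i"
    proof (rule ccontr)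
      assume "\<not> j < row p i"
      moreover have "\<not> i < row p j" using calculation assms(1) by (simp add: self_conjugate_iff)
      ultimately show False using eq assms(2) by (simp add: beta_def)
    qed
    hence "hook_length p (i, j) = t" "(i, j) \<in> young_diagram p"
      using hook_length_self_conjugate[OF assms(1), of j i] eq by (simp_all add: young_diagram_iff)
    thus False using core by (auto simp: is_core_def)
  qed
next
  assume *: "\<forall>i j. beta p i + beta p j \<noteq> 2 * int t"
  show "is_core t p" unfolding is_core_def
  proof
    fix x assume "x \<in> young_diagram p"
    moreover obtain i j where "x = (i, j)" by (cases x)
    ultimately show "hook_length p x \<noteq> t"
      using hook_length_self_conjugate[OF assms(1), of j i] *[rule_format, of i j]
      by (auto simp: young_diagram_iff)
  qed
qed

section \<open>Bijection between self-conjugate cores and symmetric closed sets\<close>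

lemma beta_strict_antimono:
  assumes "is_partition p" "i < j"
  shows "beta p j < beta p i"
  using row_antimono[OF assms(1), of i j] assms(2) by (simp add: beta_def)

lemma odd_beta: "odd (beta p i)"
  by (simp add: beta_def)

lemma range_beta_symmetric:
  assumes "is_partition p" "self_conjugate p" "odd y"
  shows "y \<in> range (beta p) \<longleftrightarrow> - y \<notin> range (beta p)"
proof -
  have sym: "\<And>i j. j < row p i \<longleftrightarrow> i < row p j" using assms(2) by (simp add: self_conjugate_iff)
  \<comment> \<open>A box at \<open>(i, j)\<close> makes the sum at least 2, a missing box makes it
    at most -2.\<close>
  have disj: "beta p i + beta p j \<noteq> 0" for i j
    using sym[of j i] by (cases "j < row p i") (auto simp: beta_def)
  \<comment> \<open>If the decreasing sequence jumps over \<open>2 n + 1\<close> at index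
    \<open>i\<close>, then column \<open>i + n\<close> has length exactly \<open>i\<close>, and so
    has row \<open>i + n\<close>.\<close>
  have cover: "beta p i = 2 * int n + 1 \<or> (\<exists>j. beta p j = - (2 * int n + 1))"
    if i: "i = (LEAST i. beta p i \<le> 2 * int n + 1)" for i n
  proof -
    have "beta p (row p 0) \<le> 2 * int n + 1"
      using row_antimono[OF assms(1), of 0 "row p 0"] by (simp add: beta_def)
    hence le: "beta p i \<le> 2 * int n + 1" unfolding i by (rule LeastI)
    show ?thesis
    proof (cases "beta p i = 2 * int n + 1")
      case False
      with le have "row p i \<le> i + n" by (simp add: beta_def)
      hence "row p (i + n) \<le> i" using sym[of "i + n" i] by simp
      moreover have "i \<le> row p (i + n)"
      proof (cases i)
        case (Suc k)
        hence "\<not> beta p k \<le> 2 * int n + 1" using i by (metis lessI not_less_Least)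
        hence "i + n < row p k" using Suc by (simp add: beta_def)
        thus ?thesis using sym[of "i + n" k] Suc by simp
      qed simp
      ultimately have "beta p (i + n) = - (2 * int n + 1)" by (simp add: beta_def)
      thus ?thesis by blast
    qed simp
  qed
  have pos: "y \<in> range (beta p) \<or> - y \<in> range (beta p)" if "odd y" "0 < y" for y
  proof -
    from that obtain m where m: "y = 2 * m + 1" by (auto elim: oddE)
    with that have "y = 2 * int (nat m) + 1" by simp
    then obtain n where "y = 2 * int n + 1" by blast
    thus ?thesis using cover[OF refl, of n] by (metis rangeI)
  qed
  have "y \<in> range (beta p) \<or> - y \<in> range (beta p)"
    using pos[of y] pos[of "- y"] assms(3) by (cases y "0 :: int" rule: linorder_cases) auto
  moreover have "\<not> (y \<in> range (beta p) \<and> - y \<in> range (beta p))"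
    using disj by (metis add.right_inverse imageE)
  ultimately show ?thesis by blast
qed

text \<open>If \<open>y\<close> belongs to the range and \<open>y - 2 t\<close> does not, symmetry
  puts \<open>2 t - y\<close> into it, which together with \<open>y\<close> gives the forbidden sum
  \<open>2 t\<close>.\<close>

lemma range_beta_in:
  assumes "p \<in> self_conjugate_core_partitions ts" "\<forall>t\<in>set ts. 0 < t"
  shows "range (beta p) \<in> symmetric_closed_sets ts"
proof -
  have p: "is_partition p" "self_conjugate p" "is_multicore ts p"
    using assms(1) by (auto simp: self_conjugate_core_partitions_def)
  note symm = range_beta_symmetric[OF p(1,2)]
  have "y - 2 * int t \<in> range (beta p)" if "t \<in> set ts" and y: "y \<in> range (beta p)" for t y
  proof (rule ccontr)
    assume *: "y - 2 * int t \<notin> range (beta p)"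
    have "odd y" using y odd_beta by auto
    hence "- (y - 2 * int t) \<in> range (beta p)" using * symm[of "y - 2 * int t"] by simp
    then obtain i j where "beta p i = y" "beta p j = - (y - 2 * int t)" using y by (metis rangeE)
    hence "beta p i + beta p j = 2 * int t" by simp
    thus False
      using is_core_iff_beta[OF p(2), of t] p(3) assms(2) that(1) by (auto simp: is_multicore_def)
  qed
  moreover have "beta p i \<le> beta p 0" for i
    using beta_strict_antimono[OF p(1), of 0 i] by (cases "i = 0") auto
  ultimately show ?thesis
    unfolding symmetric_closed_sets_def using symm odd_beta by blast
qed

text \<open>Both sequences list the common range from the top: the \<open>i\<close>-th value is the
  largest one not taken at smaller indices.\<close>

lemma strict_antimono_range_eq:
  fixes f g :: "nat \<Rightarrow> int"
  assumes f: "\<And>i j. i < j \<Longrightarrow> f j < f i" and g: "\<And>i j. i < j \<Longrightarrow> g j < g i"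
    and eq: "range f = range g"
  shows "f = g"
proof
  fix i
  have le: "f' i \<le> g' i"
    if f': "\<And>i j. i < j \<Longrightarrow> f' j < f' i" and g': "\<And>i j. i < j \<Longrightarrow> g' j < g' i"
      and eq: "range f' = range g'" and IH: "\<And>k. k < i \<Longrightarrow> f' k = g' k"
    for i and f' g' :: "nat \<Rightarrow> int"
  proof -
    have "f' i \<in> range g'" using eq by blast
    then obtain k where k: "f' i = g' k" by auto
    hence "\<not> k < i" using IH[of k] f'[of k i] by auto
    thus ?thesis using g'[of i k] k by (cases "i = k") auto
  qed
  show "f i = g i"
  proof (induction i rule: less_induct)
    case (less i)
    thus ?case using le[of f g i, OF f g eq] le[of g f i, OF g f eq[symmetric]] by force
  qed
qed

lemma inj_on_range_beta: "inj_on (\<lambda>p. range (beta p)) (self_conjugate_core_partitions ts)"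
proof (rule inj_onI)
  fix p p'
  assume "p \<in> self_conjugate_core_partitions ts" "p' \<in> self_conjugate_core_partitions ts"
    and eq: "range (beta p) = range (beta p')"
  hence p: "is_partition p" "is_partition p'"
    by (auto simp: self_conjugate_core_partitions_def)
  have "beta p = beta p'"
    by (rule strict_antimono_range_eq[OF _ _ eq]) (use p beta_strict_antimono in blast)+
  hence "row p = row p'"
    by (auto simp: fun_eq_iff beta_def)
  thus "p = p'" using partition_eqI p by blast
qed

text \<open>With \<open>b\<close> listing \<open>B\<close> decreasingly, the diagram consists of the
  \<open>(i, j)\<close> with \<open>b i + b j > 0\<close>, which is symmetric by construction.
  Counting elements of \<open>B\<close> shows that its rows reproduce \<open>b\<close>.\<close>

lemma range_beta_surj:
  assumes B: "B \<in> symmetric_closed_sets ts" and ts: "\<forall>t\<in>set ts. 0 < t"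
  obtains p where "p \<in> self_conjugate_core_partitions ts" "range (beta p) = B"
proof -
  from B have odd: "\<And>y. y \<in> B \<Longrightarrow> odd y" and symm: "\<And>y. odd y \<Longrightarrow> y \<in> B \<longleftrightarrow> - y \<notin> B"
    and closed: "\<And>t y. t \<in> set ts \<Longrightarrow> y \<in> B \<Longrightarrow> y - 2 * int t \<in> B"
    and "\<exists>M. \<forall>y\<in>B. y \<le> M"
    unfolding symmetric_closed_sets_def mem_Collect_eq by blast+
  then obtain M0 where M0: "\<forall>y\<in>B. y \<le> M0" by blast
  \<comment> \<open>An odd upper bound, so that every element of \<open>B\<close> has the form
    \<open>M - 2 n\<close>.\<close>
  define M where "M = 2 * \<bar>M0\<bar> + 1"
  have M: "odd M" "y \<in> B \<Longrightarrow> y \<le> M" for y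
    using M0 by (force simp: M_def)+
  define C where "C = {n. M - 2 * int n \<in> B}"
  have "infinite C"
    unfolding infinite_nat_iff_unbounded_le
  proof
    fix m
    \<comment> \<open>Large enough for \<open>2 n - M\<close> to exceed \<open>M\<close>; it then
      lies outside \<open>B\<close>, and its negative inside.\<close>
    define n where "n = m + nat M + 1"
    have "2 * int n - M \<notin> B" using M(2)[of "2 * int n - M"] by (auto simp: n_def M_def)
    hence "n \<in> C" using symm[of "2 * int n - M"] M(1) by (simp add: C_def)
    thus "\<exists>n\<ge>m. n \<in> C" by (intro exI[of _ n]) (auto simp: n_def)
  qed
  define b where "b i = M - 2 * int (enumerate C i)" for i
  have b_less: "b j < b i" if "i < j" for i j
    using enumerate_mono[OF that \<open>infinite C\<close>] by (simp add: b_def)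
  have b_le_iff: "b j \<le> b i \<longleftrightarrow> i \<le> j" for i j
    using b_less[of i j] b_less[of j i] by (cases i j rule: linorder_cases) auto
  have range_b: "range b = B"
  proof (intro equalityI subsetI)
    fix y assume "y \<in> range b"
    thus "y \<in> B" using enumerate_in_set[OF \<open>infinite C\<close>] by (auto simp: b_def C_def)
  next
    fix y assume "y \<in> B"
    hence "even (M - y)" "0 \<le> M - y" using odd M by auto
    then obtain k where "M - y = 2 * k" unfolding dvd_def by blast
    with \<open>0 \<le> M - y\<close> have "M - y = 2 * int (nat k)" by simp
    then obtain m where "M - y = 2 * int m" by blast
    hence y: "y = M - 2 * int m" by simp
    hence "m \<in> C" using \<open>y \<in> B\<close> by (simp add: C_def)
    then obtain i where "enumerate C i = m" using enumerate_Ex[of C] \<open>infinite C\<close> by blast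
    thus "y \<in> range b" using y by (auto simp: b_def)
  qed
  have b_in: "b i \<in> B" for i using range_b by blast
  define above where "above x = {y \<in> B. x < y}" for x
  have fin: "finite (above x)" for x
    by (rule finite_subset[of _ "{x..M}"]) (auto simp: above_def M(2))
  define count where "count x = card (above x)" for x
  have less_count: "j < count x \<longleftrightarrow> x < b j" for j x
  proof
    have inj: "inj_on b A" for A by (rule inj_onI) (metis b_less linorder_neqE_nat order_less_irrefl)
    { assume "x < b j"
      hence "x < b i" if "i \<le> j" for i using that b_le_iff[of j i] by simp
      hence "b ` {..j} \<subseteq> above x" by (auto simp: above_def b_in)
      hence "card (b ` {..j}) \<le> count x" unfolding count_def by (rule card_mono[OF fin])
      thus "j < count x" by (simp add: card_image inj) }
    { assume "j < count x"
      show "x < b j"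
      proof (rule ccontr)
        assume "\<not> x < b j"
        hence "i < j" if "x < b i" for i using that b_le_iff[of i j] by simp
        hence "above x \<subseteq> b ` {..<j}" unfolding above_def range_b[symmetric] by blast
        hence "count x \<le> card (b ` {..<j})" unfolding count_def by (rule card_mono[rotated]) simp
        thus False using \<open>j < count x\<close> by (simp add: card_image inj)
      qed }
  qed
  have count_step: "count (x - 2) = count x + (if x \<in> B then 1 else 0)" if "odd x" for x
  proof -
    have "y = x" if "x - 2 < y" "\<not> x < y" "y \<in> B" for y
    proof -
      from that have "y = x \<or> y = x - 1" by linarith
      moreover have "y \<noteq> x - 1" using odd[OF that(3)] \<open>odd x\<close> by auto
      ultimately show ?thesis by blast
    qed
    hence "above (x - 2) = above x \<union> (if x \<in> B then {x} else {})"
      by (auto simp: above_def)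
    moreover have "x \<notin> above x" by (simp add: above_def)
    ultimately show ?thesis by (simp add: count_def fin)
  qed
  \<comment> \<open>Each of the \<open>n\<close> pairs \<open>\<plusminus>(2 k + 1)\<close> with
    \<open>k < n\<close> contributes one element; of the remaining values in between, only
    \<open>2 n + 1\<close> itself may occur.\<close>
  have count_pos: "count (- (2 * int n + 1)) =
      count (2 * int n + 1) + n + (if 2 * int n + 1 \<in> B then 1 else 0)" for n
  proof (induction n)
    case 0
    show ?case using count_step[of 1] by simp
  next
    case (Suc n)
    have "count (- (2 * int (Suc n) + 1)) =
        count (- (2 * int n + 1)) + (if - (2 * int n + 1) \<in> B then 1 else 0)"
      using count_step[of "- (2 * int n + 1)"] by (simp add: algebra_simps)
    also have "(if - (2 * int n + 1) \<in> B then 1 else 0) = (if 2 * int n + 1 \<in> B then 0 else (1::nat))"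
      using symm[of "2 * int n + 1"] by simp
    also have "count (- (2 * int n + 1)) + \<dots> = count (2 * int n + 1) + n + 1" using Suc by simp
    also have "count (2 * int n + 1) =
        count (2 * int (Suc n) + 1) + (if 2 * int (Suc n) + 1 \<in> B then 1 else 0)"
      using count_step[of "2 * int (Suc n) + 1"] by (simp add: algebra_simps)
    finally show ?case by simp
  qed
  have count_uminus: "2 * int (count (- y)) = 2 * int (count y) + y + 1" if y: "y \<in> B" for y
  proof (cases "0 < y")
    case True
    obtain m where m: "y = 2 * m + 1" using odd[OF y] by (auto elim: oddE)
    with True have "y = 2 * int (nat m) + 1" by simp
    thus ?thesis using count_pos[of "nat m"] y by simp
  next
    case False
    obtain m where m: "- y = 2 * m + 1" using odd[OF y] by (metis even_minus oddE)
    hence "y = - (2 * int (nat m) + 1)" using False by simp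
    then obtain n where n: "y = - (2 * int n + 1)" by blast
    moreover have "- y \<notin> B" using symm[of y] odd[OF y] y by simp
    ultimately show ?thesis using count_pos[of n] by (simp add: n add.commute[of 1])
  qed
  define lam where "lam i = count (- b i)" for i
  have less_lam: "j < lam i \<longleftrightarrow> 0 < b i + b j" for i j
    by (auto simp: lam_def less_count)
  hence lam_sym: "j < lam i \<longleftrightarrow> i < lam j" for i j by (simp add: add.commute)
  have lam_antimono: "lam j \<le> lam i" if "i \<le> j" for i j
  proof (rule ccontr)
    assume "\<not> lam j \<le> lam i"
    hence "0 < b j + b (lam i)" using less_lam[of "lam i" j] by simp
    moreover have "b j \<le> b i" using b_le_iff that by simp
    ultimately have "lam i < lam i" using less_lam[of "lam i" i] by simp
    thus False by simp
  qed
  have b_lam: "b i = 2 * int (lam i) - 2 * int i - 1" for i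
  proof -
    have "count (b i) = i"
      using less_count[of i "b i"] less_count[of _ "b i"] b_le_iff
      by (metis linorder_not_le nat_less_le not_less_iff_gr_or_eq)
    thus ?thesis using count_uminus[of "b i"] range_b by (auto simp: lam_def)
  qed
  \<comment> \<open>Row \<open>i\<close> is nonempty exactly if \<open>i < lam 0\<close>, by the
    symmetry of \<open>lam\<close>.\<close>
  define p where "p = map lam [0..<lam 0]"
  have row_p: "row p = lam"
  proof
    fix i show "row p i = lam i"
      using lam_sym[of i 0] by (simp add: p_def row_def)
  qed
  have p_part: "is_partition p"
    unfolding is_partition_def
  proof
    show "sorted_wrt (\<ge>) p" by (simp add: p_def sorted_wrt_iff_nth_less lam_antimono)
    show "\<forall>k\<in>set p. 0 < k" using lam_sym[where i = 0] by (auto simp: p_def)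
  qed
  have p_conj: "self_conjugate p"
    using lam_sym by (simp add: self_conjugate_iff row_p)
  have beta_p: "beta p = b"
    by (simp add: fun_eq_iff beta_def row_p b_lam)
  have "is_core t p" if t: "t \<in> set ts" for t
    unfolding is_core_iff_beta[OF p_conj ts[rule_format, OF t]]
  proof (intro allI notI)
    fix i j assume "beta p i + beta p j = 2 * int t"
    hence "b i - 2 * int t = - b j" by (simp add: beta_p)
    moreover have "b i - 2 * int t \<in> B" using closed[OF t] range_b by blast
    moreover have "b j \<in> B" using range_b by blast
    ultimately show False using symm[of "b j"] odd[of "b j"] by simp
  qed
  hence "p \<in> self_conjugate_core_partitions ts"
    using p_part p_conj by (simp add: self_conjugate_core_partitions_def is_multicore_def)
  thus thesis using that beta_p range_b by simp
qed

lemma bij_betw_range_beta: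
  assumes "\<forall>t\<in>set ts. 0 < t"
  shows "bij_betw (\<lambda>p. range (beta p)) (self_conjugate_core_partitions ts) (symmetric_closed_sets ts)"
  unfolding bij_betw_def
  using inj_on_range_beta range_beta_in[OF _ assms] range_beta_surj[OF _ assms]
  by (auto simp: image_iff) metis

section \<open>Sets of odd integers as quasiperiodic functions\<close>

lemma down_closed_int_set_bounded:
  fixes P :: "int \<Rightarrow> bool"
  assumes down: "\<And>t. P t \<Longrightarrow> P (t - 1)" and "P b" and "\<not> P a"
  obtains h where "\<And>t. P t \<longleftrightarrow> t \<le> h"
proof -
  have down_n: "P (t - int n)" if "P t" for t n
  proof (induction n)
    case (Suc n)
    thus ?case using down[of "t - int n"] by (simp add: algebra_simps)
  qed (use that in simp)
  have down_le: "P t'" if "P t" "t' \<le> t" for t t'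
    using down_n[OF that(1), of "nat (t - t')"] that(2) by simp
  have "b < a" using down_le assms(2,3) by (meson linorder_not_le)
  hence "\<not> P (b + 1 + int (nat (a - b - 1)))" using assms(3) by simp
  \<comment> \<open>The first failure above \<open>b\<close>; the integer just below it is the
    maximum.\<close>
  define n where "n = (LEAST n. \<not> P (b + 1 + int n))"
  have not_P: "\<not> P (b + 1 + int n)"
    unfolding n_def by (rule LeastI) fact
  have P: "P (b + int n)"
  proof (cases n)
    case 0
    thus ?thesis using assms(2) by simp
  next
    case (Suc m)
    hence "P (b + 1 + int m)" using not_less_Least[of m "\<lambda>n. \<not> P (b + 1 + int n)", folded n_def] by simp
    thus ?thesis using Suc by (simp add: algebra_simps)
  qed
  have "P t \<longleftrightarrow> t \<le> b + int n" for t
  proof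
    show "P t" if "t \<le> b + int n" using down_le[OF P that] .
    show "t \<le> b + int n" if "P t" using down_le[OF that, of "b + 1 + int n"] not_P by force
  qed
  thus thesis by (rule that)
qed

lemma eq_if_same_lower:
  fixes x y :: int
  assumes "\<And>t. t \<le> x \<longleftrightarrow> t \<le> y"
  shows "x = y"
  using assms[of x] assms[of y] by simp

text \<open>Both parities of \<open>s\<close> are treated at once: \<open>r\<close> is
  \<open>s div 2\<close>, and \<open>c\<close> is 1 for even \<open>s\<close> and 0 for odd
  \<open>s\<close>.\<close>

locale core_params =
  fixes s d r c :: nat
  assumes s_eq: "s + c = 2 * r + 1" and c_le: "c \<le> 1" and s_pos: "0 < s" and d_pos: "0 < d"
    and coprime_s_d: "coprime s d" and odd_d_if: "c = 1 \<Longrightarrow> odd d"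
begin

text \<open>Raising \<open>j\<close> by one adds \<open>2 d\<close>, raising \<open>t\<close> by one
  adds \<open>2 s\<close>. The offsets make all values odd and turn negation into the point
  reflection at \<open>(c / 2, 1 / 2)\<close>.\<close>

definition pos :: "int \<Rightarrow> int \<Rightarrow> int" where
  "pos j t = (2 * j - int c) * int d + (2 * t - 1) * int s"

text \<open>Subtracting \<open>2 (s + k d)\<close> moves \<open>(j, t)\<close> to
  \<open>(j - k, t - 1)\<close>, hence the inequality. The modulus \<open>s\<close> itself
  (\<open>k = 0\<close>) is reflected in the region \<open>t \<le> h j\<close> being closed
  downwards.\<close>

definition heights :: "(int \<Rightarrow> int) set" where
  "heights = {h. (\<forall>j. h (j + int s) = h j - int d) \<and> (\<forall>j. h (int c - j) = - h j) \<and>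
     (\<forall>j. \<forall>k\<in>{1, 2, 3}. h j \<le> h (j - k) + 1)}"

definition set_of :: "(int \<Rightarrow> int) \<Rightarrow> int set" where
  "set_of h = {pos j t |j t. t \<le> h j}"

lemma c_cases: "c = 0 \<or> c = 1"
  using c_le by auto

lemma odd_pos: "odd (pos j t)"
proof -
  have "odd (int c * int d + int s)"
    using c_cases
  proof
    assume "c = 0"
    hence "s = 2 * r + 1" using s_eq by simp
    thus ?thesis using \<open>c = 0\<close> by simp
  next
    assume "c = 1"
    hence "s = 2 * r" using s_eq by simp
    thus ?thesis using \<open>c = 1\<close> odd_d_if by simp
  qed
  moreover have "pos j t = 2 * (j * int d + t * int s) - (int c * int d + int s)"
    by (simp add: pos_def algebra_simps)
  ultimately show ?thesis by simp
qed

lemma pos_uminus: "- pos j t = pos (int c - j) (1 - t)"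
  by (simp add: pos_def algebra_simps)

lemma pos_shift: "pos (j + m * int s) t = pos j (t + m * int d)"
  by (simp add: pos_def algebra_simps)

lemma pos_diff: "pos j t - 2 * (int s + k * int d) = pos (j - k) (t - 1)"
  by (simp add: pos_def algebra_simps)

text \<open>Coprimality turns \<open>(j - j') d = (t' - t) s\<close> into divisibility of
  \<open>j - j'\<close> by \<open>s\<close>.\<close>

lemma pos_eqD:
  assumes "pos j t = pos j' t'"
  obtains m where "j = j' + m * int s" "t' = t + m * int d"
proof -
  have eq: "(j - j') * int d = (t' - t) * int s"
    using assms by (simp add: pos_def algebra_simps)
  hence "int s dvd (j - j') * int d" by simp
  hence "int s dvd j - j'"
    using coprime_s_d by (simp add: coprime_dvd_mult_left_iff)
  then obtain m where m: "j - j' = int s * m" by (auto elim: dvdE)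
  with eq have "int s * (m * int d) = int s * (t' - t)" by (simp add: algebra_simps)
  hence "m * int d = t' - t" using s_pos by simp
  thus thesis using that[of m] m by (simp add: algebra_simps)
qed

lemma pos_surj:
  assumes "odd y"
  obtains j t where "y = pos j t"
proof -
  have "even (y - pos 0 0)" using assms odd_pos[of 0 0] by simp
  then obtain w where w: "y - pos 0 0 = 2 * w" unfolding dvd_def by blast
  obtain u v where "u * int d + v * int s = gcd (int d) (int s)"
    using bezout_int by blast
  also have "\<dots> = 1" using coprime_s_d by (simp add: coprime_commute)
  finally have uv: "u * int d + v * int s = 1" .
  have "pos (w * u) (w * v) = pos 0 0 + 2 * (w * (u * int d + v * int s))"
    by (simp add: pos_def algebra_simps)
  hence "y = pos (w * u) (w * v)" using w uv by simp
  thus thesis by (rule that)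
qed

lemma height_shift:
  assumes "h \<in> heights"
  shows "h (j + m * int s) = h j - m * int d"
proof -
  have step: "h (j + int s) = h j - int d" for j using assms by (simp add: heights_def)
  have nat: "h (j + int n * int s) = h j - int n * int d" for n j
  proof (induction n)
    case (Suc n)
    thus ?case using step[of "j + int n * int s"] by (simp add: algebra_simps)
  qed simp
  show ?thesis
  proof (cases "0 \<le> m")
    case True
    thus ?thesis using nat[of j "nat m"] by simp
  next
    case False
    thus ?thesis using nat[of "j + m * int s" "nat (- m)"] by simp
  qed
qed

lemma pos_in_set_of_iff:
  assumes "h \<in> heights"
  shows "pos j t \<in> set_of h \<longleftrightarrow> t \<le> h j"
proof
  assume "pos j t \<in> set_of h"
  then obtain j' t' where *: "pos j t = pos j' t'" "t' \<le> h j'" by (auto simp: set_of_def)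
  from pos_eqD[OF *(1)] obtain m where "j = j' + m * int s" "t' = t + m * int d" .
  thus "t \<le> h j" using *(2) height_shift[OF assms, of j' m] by simp
qed (auto simp: set_of_def)

abbreviation moduli :: "nat list" where
  "moduli \<equiv> [s, s + d, s + 2 * d, s + 3 * d]"

lemma moduli_iff: "t \<in> set moduli \<longleftrightarrow> (\<exists>k\<in>{0, 1, 2, 3}. int t = int s + k * int d)"
  by auto

lemma set_of_in:
  assumes h: "h \<in> heights"
  shows "set_of h \<in> symmetric_closed_sets moduli"
proof -
  note mem = pos_in_set_of_iff[OF h]
  have "odd y" if "y \<in> set_of h" for y
    using that odd_pos by (auto simp: set_of_def)
  moreover have "y \<in> set_of h \<longleftrightarrow> - y \<notin> set_of h" if "odd y" for y
  proof -
    from pos_surj[OF that] obtain j t where y: "y = pos j t" .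
    have "h (int c - j) = - h j" using h by (simp add: heights_def)
    thus ?thesis unfolding y pos_uminus mem by auto
  qed
  moreover have "\<exists>M. \<forall>y\<in>set_of h. y \<le> M"
  proof (intro exI ballI)
    \<comment> \<open>Every point can be moved by \<open>pos_shift\<close> into one period of
      columns, whose finitely many tops bound the set.\<close>
    let ?S = "(\<lambda>j. pos j (h j)) ` {0..<int s}"
    fix y assume "y \<in> set_of h"
    then obtain j t where y: "y = pos j t" "t \<le> h j" by (auto simp: set_of_def)
    let ?j = "j mod int s" and ?m = "j div int s"
    have j: "j = ?j + ?m * int s" by simp
    have "y = pos ?j (t + ?m * int d)" using y(1) pos_shift[of ?j ?m t] by simp
    moreover have "t + ?m * int d \<le> h ?j" using y(2) height_shift[OF h, of ?j ?m] by simp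
    ultimately have "y \<le> pos ?j (h ?j)" by (simp add: pos_def mult_right_mono)
    moreover have "pos ?j (h ?j) \<in> ?S" using s_pos by (intro imageI) simp
    hence "pos ?j (h ?j) \<le> Max ?S" by (intro Max_ge) auto
    ultimately show "y \<le> Max ?S" by simp
  qed
  moreover have "y - 2 * int t \<in> set_of h" if "t \<in> set moduli" "y \<in> set_of h" for t y
  proof -
    from that(1) obtain k where k: "k \<in> {0, 1, 2, 3}" "int t = int s + k * int d"
      unfolding moduli_iff by blast
    from that(2) obtain j u where y: "y = pos j u" "u \<le> h j" by (auto simp: set_of_def)
    have "h j \<le> h (j - k) + 1" using h k(1) by (auto simp: heights_def)
    thus ?thesis unfolding k(2) y(1) pos_diff mem using y(2) by simp
  qed
  ultimately show ?thesis unfolding symmetric_closed_sets_def by blast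
qed

lemma inj_on_set_of: "inj_on set_of heights"
proof (rule inj_onI)
  fix h h' assume *: "h \<in> heights" "h' \<in> heights" "set_of h = set_of h'"
  have "h j = h' j" for j
    by (rule eq_if_same_lower) (use * pos_in_set_of_iff in metis)
  thus "h = h'" by blast
qed

text \<open>In each column \<open>j\<close> the members of \<open>B\<close> form a down-set by
  closure under \<open>s\<close>. It is not everything, as \<open>B\<close> is bounded, and not
  empty, as the reflected column misses a point. Its maximum is \<open>h j\<close>.\<close>

lemma set_of_surj:
  assumes B: "B \<in> symmetric_closed_sets moduli"
  obtains h where "h \<in> heights" "set_of h = B"
proof -
  from B have odd: "\<And>y. y \<in> B \<Longrightarrow> odd y" and symm: "\<And>y. odd y \<Longrightarrow> y \<in> B \<longleftrightarrow> - y \<notin> B"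
    and closed: "\<And>t y. t \<in> set moduli \<Longrightarrow> y \<in> B \<Longrightarrow> y - 2 * int t \<in> B"
    and "\<exists>M. \<forall>y\<in>B. y \<le> M"
    unfolding symmetric_closed_sets_def mem_Collect_eq by blast+
  then obtain M where M: "\<forall>y\<in>B. y \<le> M" by blast
  have closed': "pos (j - k) (t - 1) \<in> B" if "pos j t \<in> B" "k \<in> {0, 1, 2, 3}" for j t k
  proof -
    have "int (nat (int s + k * int d)) = int s + k * int d" using that(2) by auto
    hence "nat (int s + k * int d) \<in> set moduli" using that(2) unfolding moduli_iff by blast
    from closed[OF this that(1)] show ?thesis
      using \<open>int (nat _) = _\<close> pos_diff by simp
  qed
  have ex_notin: "\<exists>t. pos j t \<notin> B" for j
  proof -
    define X where "X = (2 * j - int c) * int d"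
    \<comment> \<open>Makes \<open>2 t - 1\<close> exceed \<open>M - X\<close>, so that
      \<open>pos j t\<close> lies above the bound \<open>M\<close>.\<close>
    define t where "t = \<bar>M\<bar> + \<bar>X\<bar> + 1"
    have "(2 * t - 1) * 1 \<le> (2 * t - 1) * int s"
      using s_pos by (intro mult_left_mono) (auto simp: t_def)
    hence "X + (2 * t - 1) \<le> X + (2 * t - 1) * int s" by simp
    also have "X + (2 * t - 1) * int s = pos j t" by (simp add: pos_def X_def)
    finally have "M < pos j t" by (simp add: t_def)
    hence "pos j t \<notin> B" using M by force
    thus "\<exists>t. pos j t \<notin> B" by blast
  qed
  have "\<exists>h. \<forall>t. pos j t \<in> B \<longleftrightarrow> t \<le> h" for j
  proof -
    obtain a where a: "pos j a \<notin> B" using ex_notin by blast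
    obtain b where b: "pos (int c - j) b \<notin> B" using ex_notin by blast
    have "pos j (1 - b) \<in> B"
      using symm[OF odd_pos, of "int c - j" b] b pos_uminus[of "int c - j" b] by simp
    moreover have "pos j (t - 1) \<in> B" if "pos j t \<in> B" for t
      using closed'[OF that, of 0] by simp
    ultimately obtain h where "\<And>t. pos j t \<in> B \<longleftrightarrow> t \<le> h"
      using down_closed_int_set_bounded[of "\<lambda>t. pos j t \<in> B" "1 - b" a] a by blast
    thus ?thesis by blast
  qed
  then obtain h where h: "\<And>j t. pos j t \<in> B \<longleftrightarrow> t \<le> h j" by metis
  have "h (j + int s) = h j - int d" for j
  proof (rule eq_if_same_lower)
    show "t \<le> h (j + int s) \<longleftrightarrow> t \<le> h j - int d" for t
      using h[of "j + int s" t] h[of j "t + int d"] pos_shift[of j 1 t] by auto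
  qed
  moreover have "h (int c - j) = - h j" for j
  proof (rule eq_if_same_lower)
    show "t \<le> h (int c - j) \<longleftrightarrow> t \<le> - h j" for t
      using h[of "int c - j" t] h[of j "1 - t"] symm[OF odd_pos, of j "1 - t"]
        pos_uminus[of j "1 - t"] by auto
  qed
  moreover have "h j \<le> h (j - k) + 1" if "k \<in> {1, 2, 3}" for j k
  proof -
    have "pos (j - k) (h j - 1) \<in> B" using that by (intro closed') (auto simp: h)
    thus ?thesis by (simp add: h)
  qed
  ultimately have heights: "h \<in> heights" by (simp add: heights_def)
  have "set_of h = B"
  proof (intro equalityI subsetI)
    fix y assume "y \<in> B"
    with odd obtain j t where "y = pos j t" using pos_surj by blast
    thus "y \<in> set_of h" using \<open>y \<in> B\<close> h by (auto simp: set_of_def)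
  qed (auto simp: set_of_def h)
  with heights show thesis by (rule that)
qed

lemma bij_betw_set_of: "bij_betw set_of heights (symmetric_closed_sets moduli)"
  unfolding bij_betw_def
proof (intro conjI equalityI subsetI inj_on_set_of)
  show "B \<in> symmetric_closed_sets moduli" if "B \<in> set_of ` heights" for B
    using that set_of_in by blast
  show "B \<in> set_of ` heights" if "B \<in> symmetric_closed_sets moduli" for B
    using set_of_surj[OF that] by blast
qed

end

section \<open>Words avoiding small consecutive sums\<close>

lemma nat_cases_3:
  fixes r :: nat
  obtains "r = 0" | "r = 1" | "r = 2" | k where "r = k + 3"
proof -
  have "r = 0 \<or> r = 1 \<or> r = 2 \<or> r = (r - 3) + 3" by arith
  thus thesis using that by blast
qed

text \<open>
  The state \<open>k\<close> is what the previous two letters still demand: the next letter must be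
  positive if \<open>k > 0\<close>, and the next two letters must sum to at least \<open>k\<close>. The last letter \<open>e\<close>
  stands for the entry \<open>2 e + q\<close> on the axis of symmetry.
\<close>

fun adm :: "nat \<Rightarrow> nat \<Rightarrow> nat list \<Rightarrow> bool" where
  "adm q k [] = False"
| "adm q k [e] = (k \<le> 2 * e + q)"
| "adm q k (b # c # bs) =
     (if k = 0 then adm q (if b = 0 then 2 else 0) (c # bs)
      else 1 \<le> b \<and> adm q (k - b) (c # bs))"

definition words :: "nat \<Rightarrow> nat \<Rightarrow> nat \<Rightarrow> nat \<Rightarrow> nat list set" where
  "words q k r N = {xs. length xs = Suc r \<and> sum_list xs = N \<and> adm q k xs}"

lemma finite_words: "finite (words q k r N)"
proof -
  have "words q k r N \<subseteq> {xs. set xs \<subseteq> {..N} \<and> length xs = Suc r}"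
    by (auto simp: words_def dest: member_le_sum_list)
  thus ?thesis by (rule finite_subset) (simp add: finite_lists_length_eq)
qed

lemma words_0: "words q k 0 N = (if k \<le> 2 * N + q then {[N]} else {})"
  by (auto simp: words_def length_Suc_conv)

lemma card_words_0: "card (words q k 0 N) = (if k \<le> 2 * N + q then 1 else 0)"
  by (simp add: words_0)

lemma Cons_in_words_iff:
  "b # ys \<in> words q k (Suc r) N \<longleftrightarrow>
     b \<le> N \<and> (0 < k \<longrightarrow> 1 \<le> b) \<and>
     ys \<in> words q (if k = 0 then if b = 0 then 2 else 0 else k - b) r (N - b)"
  by (cases ys) (auto simp: words_def)

lemma words_Suc:
  "words q k (Suc r) N = (\<Union>b\<in>{(if k = 0 then 0 else 1)..N}.
     (#) b ` words q (if k = 0 then if b = 0 then 2 else 0 else k - b) r (N - b))"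
  (is "_ = ?R")
proof (rule set_eqI)
  fix xs
  show "xs \<in> words q k (Suc r) N \<longleftrightarrow> xs \<in> ?R"
  proof (cases xs)
    case Nil
    thus ?thesis by (auto simp: words_def)
  next
    case (Cons b ys)
    thus ?thesis by (simp add: Cons_in_words_iff image_iff) (auto simp: Bex_def)
  qed
qed

lemma card_words_Suc:
  "card (words q k (Suc r) N) = (\<Sum>b\<in>{(if k = 0 then 0 else 1)..N}.
     card (words q (if k = 0 then if b = 0 then 2 else 0 else k - b) r (N - b)))"
  unfolding words_Suc
  by (subst card_UN_disjoint) (auto simp: finite_words card_image)

lemma card_words_1_sum: "card (words q (Suc 0) (Suc r) N) = (\<Sum>b=1..N. card (words q 0 r (N - b)))"
  by (simp add: card_words_Suc)

lemma words_Suc_0: "0 < k \<Longrightarrow> words q k (Suc r) 0 = {}"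
  by (simp add: words_Suc)

lemma sum_split_first:
  fixes f :: "nat \<Rightarrow> nat"
  shows "(\<Sum>b=Suc 0..Suc N. f b) = f (Suc 0) + (\<Sum>b=Suc 0..N. f (Suc b))"
  by (induction N) auto

text \<open>A positive first letter is either 1, leaving state 0, or remains positive when lowered
  by one.\<close>

lemma card_words_1:
  "card (words q (Suc 0) (Suc r) (Suc N)) = card (words q 0 r N) + card (words q (Suc 0) (Suc r) N)"
  unfolding card_words_1_sum
  by (simp add: sum_split_first del: sum.cl_ivl_Suc)

text \<open>A zero first letter leads to state 2; a positive one leads to state 0, just as it does
  from state 1.\<close>

lemma card_words_free:
  "card (words q 0 (Suc r) N) = card (words q 2 r N) + card (words q (Suc 0) (Suc r) N)"
proof -
  have "card (words q 0 (Suc r) N) =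
      card (words q 2 r N) + (\<Sum>b=Suc 0..N. card (words q (if b = 0 then 2 else 0) r (N - b)))"
    by (simp only: card_words_Suc if_True simp_thms) (subst sum.atLeast_Suc_atMost, simp_all)
  thus ?thesis unfolding card_words_1_sum by simp
qed

text \<open>First letter 1 leaves state 1. A larger first letter, lowered by one, gives an arbitrary
  word from state 1.\<close>

lemma card_words_2:
  "card (words q 2 (Suc r) (Suc N)) = card (words q (Suc 0) r N) + card (words q (Suc 0) (Suc r) N)"
proof -
  have "card (words q 2 (Suc r) (Suc N)) = (\<Sum>b=Suc 0..Suc N. card (words q (2 - b) r (Suc N - b)))"
    by (simp add: card_words_Suc)
  also have "\<dots> = card (words q (Suc 0) r N) + (\<Sum>b=Suc 0..N. card (words q (1 - b) r (N - b)))"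
    by (simp add: sum_split_first del: sum.cl_ivl_Suc)
  finally show ?thesis unfolding card_words_1_sum by simp
qed

section \<open>Binomial sums and their recurrence\<close>

definition binom_term :: "nat \<Rightarrow> nat \<Rightarrow> nat \<Rightarrow> nat" where
  "binom_term r N i = (if 2 * i \<le> r then ((N - i) choose (r - 2 * i)) * ((N - i) choose i) else 0)"

definition binom_sum :: "nat \<Rightarrow> nat \<Rightarrow> nat" where
  "binom_sum r N = (\<Sum>i\<le>N. binom_term r N i)"

text \<open>Terms beyond \<open>r div 2\<close> vanish by the guard, which stops truncated
  subtraction from producing a lower index 0; terms beyond \<open>N\<close> vanish by the second
  binomial.\<close>

lemma binom_sum_eq: "r div 2 \<le> m \<Longrightarrow> binom_sum r N = (\<Sum>i\<le>m. binom_term r N i)"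
  unfolding binom_sum_def
  by (rule sum.mono_neutral_cong) (auto simp: binom_term_def)

lemma binom_sum_0 [simp]: "binom_sum 0 N = 1"
  by (subst binom_sum_eq[of _ 0]) (auto simp: binom_term_def)

lemma binom_sum_1 [simp]: "binom_sum (Suc 0) N = N"
  by (subst binom_sum_eq[of _ 0]) (auto simp: binom_term_def)

lemma binom_sum_N_0: "binom_sum (Suc r) 0 = 0"
  by (simp add: binom_sum_def binom_term_def)

lemma binom_sum_N_1: "binom_sum r (Suc 0) = (Suc 0 choose r)"
  by (simp add: binom_sum_def binom_term_def)

lemma binom_term_rec_0: "binom_term (Suc r) (Suc N) 0 = binom_term (Suc r) N 0 + binom_term r N 0"
  by (simp add: binom_term_def)

text \<open>Applying Pascal's rule to both binomials on the left gives a product of two sums, and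
  its four terms are those on the right.\<close>

lemma binom_term_rec:
  "binom_term (r + 3) (N + 2) (Suc i) =
     binom_term (r + 3) (N + 1) (Suc i) + binom_term (r + 2) (N + 1) (Suc i) + binom_term (r + 1) N i + binom_term r N i"
proof (cases "i \<le> N")
  case True
  then obtain m where N: "N = i + m" by (auto simp: le_iff_add)
  have e: "Suc (i + m) - i = Suc m" "i + m + 2 - Suc i = Suc m" "i + m + 1 - Suc i = m" by auto
  consider "2 * i \<le> r" | "2 * i = Suc r" | "r + 1 < 2 * i" by linarith
  thus ?thesis
  proof cases
    case 1
    then obtain l where l: "r = 2 * i + l" by (auto simp: le_iff_add)
    show ?thesis
      by (simp add: binom_term_def N l e algebra_simps Suc_diff_le)
  next
    \<comment> \<open>Here the first binomial on the left has lower index 0, so only the second one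
      splits and two terms survive.\<close>
    case 2
    hence "r + 3 - 2 * Suc i = 0" "r + 3 = 2 * Suc i" by auto
    thus ?thesis using 2 by (simp add: binom_term_def N e)
  next
    case 3 thus ?thesis by (simp add: binom_term_def)
  qed
next
  case False
  thus ?thesis by (cases i) (auto simp: binom_term_def)
qed

lemma binom_sum_rec: "binom_sum (r + 3) (N + 2) = binom_sum (r + 3) (N + 1) + binom_sum (r + 2) (N + 1) + binom_sum (r + 1) N + binom_sum r N"
proof -
  have split: "binom_sum k M = binom_term k M 0 + (\<Sum>i\<le>r+2. binom_term k M (Suc i))" if "k \<le> r + 3" for k M
    using that by (subst binom_sum_eq[of _ "Suc (r + 2)"]) (auto simp: sum.atMost_Suc_shift simp del: sum.atMost_Suc)
  have "binom_sum (r + 3) (N + 2) = binom_term (r + 3) (N + 2) 0 + (\<Sum>i\<le>r+2. binom_term (r + 3) (N + 2) (Suc i))"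
    by (rule split) simp
  also have "binom_term (r + 3) (N + 2) 0 = binom_term (r + 3) (N + 1) 0 + binom_term (r + 2) (N + 1) 0"
    using binom_term_rec_0[of "r + 2" "N + 1"] by (simp add: numeral_eq_Suc)
  also have "(\<Sum>i\<le>r+2. binom_term (r + 3) (N + 2) (Suc i)) =
      (\<Sum>i\<le>r+2. binom_term (r + 3) (N + 1) (Suc i)) + (\<Sum>i\<le>r+2. binom_term (r + 2) (N + 1) (Suc i)) +
      (\<Sum>i\<le>r+2. binom_term (r + 1) N i) + (\<Sum>i\<le>r+2. binom_term r N i)"
    by (simp only: binom_term_rec sum.distrib)
  also have "(\<Sum>i\<le>r+2. binom_term (r + 1) N i) = binom_sum (r + 1) N" by (rule binom_sum_eq[symmetric]) simp
  also have "(\<Sum>i\<le>r+2. binom_term r N i) = binom_sum r N" by (rule binom_sum_eq[symmetric]) simp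
  finally show ?thesis by (simp add: split)
qed

text \<open>The recurrence one step below its range: the term of index -1 is zero, and the final 1
  is \<open>binom_sum 0 N\<close>.\<close>

lemma binom_sum_2_Suc: "binom_sum 2 (N + 2) = binom_sum 2 (N + 1) + binom_sum 1 (N + 1) + 1"
proof -
  have "binom_sum 2 M = binom_term 2 M 0 + binom_term 2 M 1" for M
    by (subst binom_sum_eq[of _ 1]) auto
  thus ?thesis by (simp add: binom_term_def numeral_eq_Suc)
qed

section \<open>Word counts as binomial sums\<close>

lemma card_words_1_N_0: "card (words q (Suc 0) r 0) = (if r = 0 \<and> 0 < q then 1 else 0)"
  by (cases r) (auto simp: card_words_0 words_Suc_0)

text \<open>Eliminating states 0 and 2 from the three first-letter recurrences leaves the recurrence
  of \<open>binom_sum\<close>.\<close>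

lemma card_words_1_rec:
  "card (words q (Suc 0) (r + 3) (N + 2)) = card (words q (Suc 0) (r + 3) (N + 1)) +
     card (words q (Suc 0) (r + 2) (N + 1)) + card (words q (Suc 0) (r + 1) N) + card (words q (Suc 0) r N)"
  using card_words_1[of q "r + 2" "N + 1"] card_words_free[of q "r + 1" "N + 1"]
    card_words_2[of q r N] by (simp add: numeral_eq_Suc)

lemma card_words_1_len_1_Suc: "card (words q (Suc 0) (Suc 0) (Suc N)) = card (words q (Suc 0) (Suc 0) N) + 1"
  using card_words_1[of q 0 N] by (simp add: card_words_0)

lemma card_words_1_len_2_Suc:
  "card (words q (Suc 0) 2 (Suc N)) = card (words q (Suc 0) 2 N) + card (words q (Suc 0) 1 N) +
     (if 0 < N then 1 else 0)" if "q \<le> 1"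
  using that card_words_1[of q 1 N] card_words_free[of q 0 N]
  by (auto simp: card_words_0 numeral_eq_Suc)

lemma card_words_1_len_1: "card (words q (Suc 0) (Suc 0) N) = N"
proof (induction N)
  case 0 show ?case by (simp add: card_words_1_N_0)
next
  case (Suc N) thus ?case using card_words_1_len_1_Suc[of q N] by simp
qed

lemma card_words_1_N_1: "card (words q (Suc 0) (r + 2) 1) = 0" if "q \<le> 1"
proof (cases r)
  case 0 thus ?thesis using card_words_1_len_2_Suc[OF that, of 0] card_words_1_len_1[of q 0]
    by (simp add: card_words_1_N_0 numeral_eq_Suc words_Suc_0)
next
  case (Suc r')
  show ?thesis using card_words_1[of q "r' + 2" 0] card_words_free[of q "r' + 1" 0]
    Suc by (simp add: words_Suc_0 numeral_eq_Suc)
qed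

lemma card_words_1_len_2: "card (words q (Suc 0) 2 N) = binom_sum 2 N" if "q \<le> 1"
proof (induction N)
  case 0 show ?case using binom_sum_N_0[of 1] card_words_1_N_0[of q 2] by (simp add: numeral_eq_Suc)
next
  case (Suc N)
  show ?case
  proof (cases N)
    case 0 thus ?thesis using card_words_1_N_1[OF that, of 0] binom_sum_N_1[of 2] by (simp add: numeral_2_eq_2)
  next
    case (Suc M)
    thus ?thesis using card_words_1_len_2_Suc[OF that, of N] Suc.IH binom_sum_2_Suc[of M] card_words_1_len_1[of q N]
      by simp
  qed
qed

lemma card_words_full: "card (words (Suc 0) (Suc 0) r N) = binom_sum r N"
proof (induction N arbitrary: r rule: less_induct)
  case (less N)
  consider "r = 0" | "r = 1" | "r = 2" | r' where "r = r' + 3"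
    by (rule nat_cases_3[of "r"])
  thus ?case
  proof cases
    case 4
    consider "N = 0" | "N = 1" | M where "N = M + 2"
      by (rule nat_cases_3[of N]) (auto simp: numeral_eq_Suc)
    thus ?thesis
    proof cases
      case 1 thus ?thesis using 4 by (simp add: card_words_1_N_0 binom_sum_N_0 words_Suc_0 numeral_eq_Suc)
    next
      case 2 thus ?thesis using 4 card_words_1_N_1[of 1 "r' + 1"] binom_sum_N_1[of r]
        by (simp add: numeral_eq_Suc)
    next
      case (3 M)
      show ?thesis unfolding 4 3 binom_sum_rec card_words_1_rec
        using 3 less.IH[of "M + 1"] less.IH[of M] by simp
    qed
  qed (simp_all add: card_words_0 card_words_1_len_1 card_words_1_len_2[of "Suc 0"])
qed

text \<open>The correction term counts the words ending in 0, 1, 0, which only \<open>q = 1\<close> admits.\<close>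

lemma card_words_half:
  assumes "0 < N"
  shows "card (words 0 (Suc 0) r N) + (if 3 \<le> r \<and> 2 \<le> N then binom_sum (r - 3) (N - 2) else 0) = binom_sum r N"
  using assms
proof (induction N arbitrary: r rule: less_induct)
  case (less N)
  consider "r = 0" | "r = 1" | "r = 2" | r' where "r = r' + 3"
    by (rule nat_cases_3[of "r"])
  thus ?case
  proof cases
    case 4
    consider "N = 1" | "N = 2" | M where "N = Suc M + 2"
      using less.prems by (cases rule: nat_cases_3[of N]) (auto simp: numeral_eq_Suc)
    thus ?thesis
    proof cases
      case 1 thus ?thesis using 4 card_words_1_N_1[of 0 "r' + 1"] binom_sum_N_1[of r]
        by (simp add: numeral_eq_Suc)
    next
      case 2
      have "binom_sum r 2 = binom_sum r 1 + binom_sum (r' + 2) 1 + binom_sum (r' + 1) 0 + binom_sum r' 0"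
        using binom_sum_rec[of r' 0] by (simp add: 4 numeral_eq_Suc)
      moreover have "card (words 0 (Suc 0) r 2) = 0"
        using card_words_1_rec[of 0 r' 0] card_words_1_N_1[of 0 "r' + 1"] card_words_1_N_1[of 0 "r'"]
        by (simp add: 4 numeral_eq_Suc card_words_1_N_0 words_Suc_0)
      ultimately show ?thesis using 4 2 binom_sum_N_1[of r] binom_sum_N_1[of "r' + 2"]
        by (simp add: binom_sum_N_0 numeral_eq_Suc)
    next
      case (3 M)
      have N: "N = (M + 1) + 2" using 3 by simp
      \<comment> \<open>\<open>u1\<close>, \<open>u2\<close>, \<open>u3\<close> are the correction
        terms in three of the four induction hypotheses.\<close>
      define u1 where "u1 = (if 1 \<le> r' then binom_sum (r' - 1) M else 0)"
      define u2 where "u2 = (if 2 \<le> r' \<and> 1 \<le> M then binom_sum (r' - 2) (M - 1) else 0)"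
      define u3 where "u3 = (if 3 \<le> r' \<and> 1 \<le> M then binom_sum (r' - 3) (M - 1) else 0)"
      note u_defs = u1_def u2_def u3_def
      have IH1: "card (words 0 (Suc 0) (r' + 3) (M + 2)) + binom_sum r' M = binom_sum (r' + 3) (M + 2)"
        using less.IH[of "M + 2" "r' + 3"] N by simp
      have IH2: "card (words 0 (Suc 0) (r' + 2) (M + 2)) + u1 = binom_sum (r' + 2) (M + 2)"
        using less.IH[of "M + 2" "r' + 2"] N by (cases r') (auto simp: u1_def numeral_eq_Suc)
      have IH3: "card (words 0 (Suc 0) (r' + 1) (M + 1)) + u2 = binom_sum (r' + 1) (M + 1)"
        using less.IH[of "M + 1" "r' + 1"] N by (auto simp: u2_def numeral_eq_Suc)
      have IH4: "card (words 0 (Suc 0) r' (M + 1)) + u3 = binom_sum r' (M + 1)"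
        using less.IH[of "M + 1" r'] N by (auto simp: u3_def numeral_eq_Suc)
      \<comment> \<open>The correction terms satisfy the recurrence themselves, so adding them to
        the counts preserves it.\<close>
      have T_r': "binom_sum r' (M + 1) = binom_sum r' M + u1 + u2 + u3"
      proof -
        consider "r' = 0" | "r' = 1" | "r' = 2" | r'' where "r' = r'' + 3"
          by (rule nat_cases_3[of "r'"])
        thus ?thesis
        proof cases
          case 3
          show ?thesis
          proof (cases M)
            case 0 thus ?thesis using 3 binom_sum_N_0[of 1] binom_sum_N_1[of 2] by (simp add: u_defs numeral_eq_Suc)
          next
            case (Suc m) thus ?thesis using 3 binom_sum_2_Suc[of m] by (simp add: u_defs)
          qed
        next
          case 4
          show ?thesis
          proof (cases M)
            case 0 thus ?thesis using 4 binom_sum_N_0 binom_sum_N_1[of r'] by (simp add: u_defs numeral_eq_Suc)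
          next
            case (Suc m) thus ?thesis using 4 binom_sum_rec[of r'' m] by (simp add: u_defs numeral_eq_Suc)
          qed
        qed (auto simp: u_defs)
      qed
      moreover have "binom_sum (r' + 3) (M + 3) =
          binom_sum (r' + 3) (M + 2) + binom_sum (r' + 2) (M + 2) + binom_sum (r' + 1) (M + 1) + binom_sum r' (M + 1)"
        using binom_sum_rec[of r' "M + 1"] by (simp add: numeral_eq_Suc)
      moreover have "card (words 0 (Suc 0) (r' + 3) (M + 3)) =
          card (words 0 (Suc 0) (r' + 3) (M + 2)) + card (words 0 (Suc 0) (r' + 2) (M + 2)) +
          card (words 0 (Suc 0) (r' + 1) (M + 1)) + card (words 0 (Suc 0) r' (M + 1))"
        using card_words_1_rec[of 0 r' "M + 1"] by (simp add: numeral_eq_Suc)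
      ultimately have "card (words 0 (Suc 0) (r' + 3) (M + 3)) + binom_sum r' (M + 1) = binom_sum (r' + 3) (M + 3)"
        using IH1 IH2 IH3 IH4 T_r' by linarith
      thus ?thesis by (simp add: 4 3 numeral_3_eq_3)
    qed
  qed (use less.prems in \<open>simp_all add: card_words_0 card_words_1_len_1 card_words_1_len_2[of 0]\<close>)
qed

text \<open>Reading terms of negative first index as zero absorbs the small values of
  \<open>r\<close> into one uniform recurrence.\<close>

lemma binom_sum_rec':
  assumes "2 \<le> N"
  shows "binom_sum r N = binom_sum r (N - 1) + (if 1 \<le> r then binom_sum (r - 1) (N - 1) else 0) +
    (if 2 \<le> r then binom_sum (r - 2) (N - 2) else 0) + (if 3 \<le> r then binom_sum (r - 3) (N - 2) else 0)"
proof -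
  obtain M where N: "N = M + 2" using assms by (metis le_add_diff_inverse2)
  show ?thesis
  proof (cases rule: nat_cases_3[of r])
    case 3
    thus ?thesis using binom_sum_2_Suc[of M] by (simp add: N)
  next
    case (4 k)
    thus ?thesis using binom_sum_rec[of k M] by (simp add: N numeral_eq_Suc)
  qed (simp_all add: N)
qed

section \<open>The closed formulas in terms of word counts\<close>

lemma sum_even_odd:
  fixes g :: "nat \<Rightarrow> nat"
  shows "(\<Sum>i=0..r. g i) =
    (\<Sum>k\<le>r. if 2 * k \<le> r then g (2 * k) else 0) +
    (\<Sum>k\<le>r. if 2 * k + 1 \<le> r then g (2 * k + 1) else 0)"
proof -
  have split: "(\<Sum>i<2*m. G i) = (\<Sum>k<m. G (2 * k)) + (\<Sum>k<m. G (2 * k + 1))"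
    for G :: "nat \<Rightarrow> nat" and m
    by (induction m) auto
  \<comment> \<open>Padding with zeros gives an even number of summands, which pair up.\<close>
  define G where "G i = (if i \<le> r then g i else 0)" for i
  have "(\<Sum>i=0..r. g i) = (\<Sum>i<2*Suc r. G i)"
    by (rule sum.mono_neutral_cong_left) (auto simp: G_def)
  also have "\<dots> = (\<Sum>k\<le>r. G (2 * k)) + (\<Sum>k\<le>r. G (2 * k + 1))"
    unfolding split lessThan_Suc_atMost ..
  finally show ?thesis by (simp only: G_def)
qed

lemma binom_sum_as_sum: "(\<Sum>i=0..r div 2. ((N - i) choose (r - 2 * i)) * ((N - i) choose i)) = binom_sum r N"
proof -
  have "binom_sum r N = (\<Sum>i\<le>r div 2. binom_term r N i)" by (rule binom_sum_eq) simp
  also have "\<dots> = (\<Sum>i=0..r div 2. ((N - i) choose (r - 2 * i)) * ((N - i) choose i))"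
    by (rule sum.cong) (auto simp: binom_term_def)
  finally show ?thesis ..
qed

text \<open>For even \<open>i\<close> Pascal's rule on the second binomial gives
  \<open>binom_sum r (N - 1)\<close> and \<open>binom_sum (r - 2) (N - 2)\<close>; odd
  \<open>i\<close> give \<open>binom_sum (r - 1) (N - 1)\<close>. This is
  \<open>binom_sum r N\<close> without the last term of its recurrence, and that term is the
  correction in \<open>card_words_half\<close>.\<close>

lemma card_words_half_as_sum:
  assumes "r < N"
  shows "(\<Sum>i=0..r. ((N - 1 - i div 2) choose (r - i)) * ((N - (i + 1) div 2) choose (i div 2)))
    = card (words 0 (Suc 0) r N)"
proof (cases "r = 0")
  case True
  thus ?thesis using card_words_half[of N r] assms by simp
next
  case False
  note r0 = this
  let ?g = "\<lambda>i. ((N - 1 - i div 2) choose (r - i)) * ((N - (i + 1) div 2) choose (i div 2))"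
  have even_0: "(if 2 * 0 \<le> r then ?g (2 * 0) else 0) = binom_term r (N - 1) 0"
    by (simp add: binom_term_def)
  have even_Suc: "(if 2 * Suc k \<le> r then ?g (2 * Suc k) else 0) =
      binom_term r (N - 1) (Suc k) + (if 2 \<le> r then binom_term (r - 2) (N - 2) k else 0)" for k
  proof (cases "2 * Suc k \<le> r")
    case True
    have "N - Suc k = Suc (N - 2 - k)" using True assms by auto
    hence "(N - Suc k) choose (Suc k) = ((N - 2 - k) choose k) + ((N - 2 - k) choose Suc k)"
      by (simp only: binomial_Suc_Suc)
    moreover have "N - 1 - Suc k = N - 2 - k" "2 * Suc k div 2 = Suc k" "(2 * Suc k + 1) div 2 = Suc k"
        "r - 2 * Suc k = r - 2 - 2 * k" "2 * k \<le> r - 2" "2 \<le> r"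
      using True by auto
    ultimately show ?thesis using True
      by (simp only: binom_term_def if_True distrib_left add.commute)
  next
    case False
    thus ?thesis by (auto simp: binom_term_def)
  qed
  have even: "(\<Sum>k\<le>r. if 2 * k \<le> r then ?g (2 * k) else 0) =
      binom_sum r (N - 1) + (if 2 \<le> r then binom_sum (r - 2) (N - 2) else 0)"
  proof -
    obtain r' where r: "r = Suc r'" using False by (cases r) auto
    have "(\<Sum>k\<le>r. if 2 * k \<le> r then ?g (2 * k) else 0) =
        (\<Sum>k\<le>Suc r'. if 2 * k \<le> r then ?g (2 * k) else 0)"
      using r by (rule arg_cong)
    also have "\<dots> = (if 2 * 0 \<le> r then ?g (2 * 0) else 0) +
        (\<Sum>k\<le>r'. if 2 * Suc k \<le> r then ?g (2 * Suc k) else 0)"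
      by (rule sum.atMost_Suc_shift)
    also have "\<dots> = binom_term r (N - 1) 0 + (\<Sum>k\<le>r'. binom_term r (N - 1) (Suc k)) +
        (\<Sum>k\<le>r'. if 2 \<le> r then binom_term (r - 2) (N - 2) k else 0)"
      by (simp only: even_0 even_Suc sum.distrib add.assoc)
    also have "binom_term r (N - 1) 0 + (\<Sum>k\<le>r'. binom_term r (N - 1) (Suc k)) = (\<Sum>k\<le>Suc r'. binom_term r (N - 1) k)"
      by (rule sum.atMost_Suc_shift[symmetric])
    also have "\<dots> = binom_sum r (N - 1)" by (rule binom_sum_eq[symmetric]) (use r in simp)
    also have "(\<Sum>k\<le>r'. if 2 \<le> r then binom_term (r - 2) (N - 2) k else 0) =
        (if 2 \<le> r then binom_sum (r - 2) (N - 2) else 0)"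
      using binom_sum_eq[of "r - 2" r' "N - 2"] r by auto
    finally show ?thesis .
  qed
  have "(if 2 * k + 1 \<le> r then ?g (2 * k + 1) else 0) = binom_term (r - 1) (N - 1) k" for k
  proof (cases "2 * k + 1 \<le> r")
    case True
    hence "N - Suc k = N - 1 - k" using assms by auto
    thus ?thesis using True by (simp add: binom_term_def)
  qed (use r0 in \<open>auto simp: binom_term_def\<close>)
  hence odd: "(\<Sum>k\<le>r. if 2 * k + 1 \<le> r then ?g (2 * k + 1) else 0) = binom_sum (r - 1) (N - 1)"
    using binom_sum_eq[of "r - 1" r "N - 1"] by simp
  show ?thesis
    unfolding sum_even_odd[of ?g] even odd
    using binom_sum_rec'[of N r] card_words_half[of N r] assms False by auto
qed

text \<open>Even \<open>i\<close> give \<open>binom_sum r N\<close>. For odd \<open>i\<close>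
  Pascal's rule on the first binomial gives the first two terms of the recurrence of
  \<open>binom_sum (r - 1) N\<close>; the other two are the corrections of the two word
  counts.\<close>

lemma card_words_two_ends_as_sum:
  assumes "0 < r" "r \<le> N"
  shows "(\<Sum>i=0..r. ((N - i div 2) choose (r - i)) * ((N - (i + 1) div 2) choose (i div 2)))
    = card (words 0 (Suc 0) (r - 1) N) + card (words 0 (Suc 0) r N)"
proof -
  let ?g = "\<lambda>i. ((N - i div 2) choose (r - i)) * ((N - (i + 1) div 2) choose (i div 2))"
  have "(if 2 * k \<le> r then ?g (2 * k) else 0) = binom_term r N k" for k
    by (auto simp: binom_term_def)
  hence even: "(\<Sum>k\<le>r. if 2 * k \<le> r then ?g (2 * k) else 0) = binom_sum r N"
    using binom_sum_eq[of r r N] by simp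
  have odd_k: "(if 2 * k + 1 \<le> r then ?g (2 * k + 1) else 0) =
      binom_term (r - 1) (N - 1) k + (if 2 \<le> r then binom_term (r - 2) (N - 1) k else 0)" for k
  proof (cases "2 * k + 1 \<le> r")
    case True
    then obtain l where l: "r = 2 * k + 1 + l" by (auto simp: le_iff_add)
    from True assms have "k + 1 \<le> N" by simp
    then obtain m where "N = k + 1 + m" by (auto simp: le_iff_add)
    hence "N - k = Suc m" "N - 1 - k = m" "N - Suc k = m" by auto
    thus ?thesis using l by (cases l) (simp_all add: binom_term_def add_mult_distrib)
  next
    case False
    thus ?thesis using assms by (auto simp: binom_term_def)
  qed
  have odd: "(\<Sum>k\<le>r. if 2 * k + 1 \<le> r then ?g (2 * k + 1) else 0) =
      binom_sum (r - 1) (N - 1) + (if 2 \<le> r then binom_sum (r - 2) (N - 1) else 0)"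
    unfolding odd_k sum.distrib using binom_sum_eq[of "r - 1" r "N - 1"] binom_sum_eq[of "r - 2" r "N - 1"]
    by auto
  show ?thesis
  proof (cases "r = 1")
    case True
    thus ?thesis unfolding sum_even_odd[of ?g] even odd
      using card_words_half[of N r] card_words_half[of N "r - 1"] assms by simp
  next
    case False
    have "r - 1 - 1 = r - 2" "r - 1 - 2 = r - 3" "r - 1 - 3 = r - 4"
      "1 \<le> r - 1 \<longleftrightarrow> 2 \<le> r" "2 \<le> r - 1 \<longleftrightarrow> 3 \<le> r" "3 \<le> r - 1 \<longleftrightarrow> 4 \<le> r" by auto
    thus ?thesis
      unfolding sum_even_odd[of ?g] even odd
      using binom_sum_rec'[of N "r - 1"] card_words_half[of N r] card_words_half[of N "r - 1"] assms False
      by (cases "r = 2"; cases "r = 3") auto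
  qed
qed

section \<open>Window conditions and the automaton\<close>

fun win :: "nat list \<Rightarrow> bool" where
  "win (x # y # z # zs) = (1 \<le> x + y \<and> 2 \<le> x + y + z \<and> win (y # z # zs))"
| "win [x, y] = (1 \<le> x + y)"
| "win _ = True"

text \<open>The parameter \<open>p\<close> is the letter preceding the word; it reappears behind the axis.\<close>

fun reflected_word :: "nat \<Rightarrow> nat \<Rightarrow> nat list \<Rightarrow> nat list" where
  "reflected_word q p [] = []"
| "reflected_word q p [e] = [2 * e + q, p]"
| "reflected_word q p (x # y # zs) = x # reflected_word q x (y # zs)"

lemma win_iff:
  "win ys \<longleftrightarrow> (\<forall>i. Suc i < length ys \<longrightarrow> 1 \<le> ys ! i + ys ! Suc i) \<and>
     (\<forall>i. Suc (Suc i) < length ys \<longrightarrow> 2 \<le> ys ! i + ys ! Suc i + ys ! Suc (Suc i))"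
proof (induction ys rule: win.induct)
  case (1 x y z zs)
  have all_Suc: "(\<forall>i. P i) \<longleftrightarrow> P 0 \<and> (\<forall>i. P (Suc i))" for P :: "nat \<Rightarrow> bool"
    by (metis nat.exhaust)
  show ?case unfolding win.simps 1
    by (subst (3 4) all_Suc) auto
qed auto

lemma length_reflected_word: "xs \<noteq> [] \<Longrightarrow> length (reflected_word q p xs) = Suc (length xs)"
  by (induction q p xs rule: reflected_word.induct) auto

lemma reflected_word_nth:
  "xs \<noteq> [] \<Longrightarrow> i \<le> length xs \<Longrightarrow> reflected_word q p xs ! i =
     (if Suc i < length xs then xs ! i else if Suc i = length xs then 2 * last xs + q
      else if length xs = 1 then p else xs ! (length xs - 2))"
proof (induction q p xs arbitrary: i rule: reflected_word.induct)
  case (2 q p e)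
  thus ?case by (cases i) auto
next
  case (3 q p x y zs)
  show ?case
  proof (cases i)
    case (Suc k)
    thus ?thesis using 3 by (cases zs) (auto simp: nth_Cons')
  qed simp
qed simp

text \<open>The state summarises the last two letters \<open>o'\<close>, \<open>p\<close>: state 0
  means \<open>p \<ge> 1\<close> and \<open>o' + p \<ge> 2\<close>, state 2 means
  \<open>p = 0\<close> after a positive letter, state 1 means 0, 1. The induction needs all three
  together; its base is given by the windows that meet the axis.\<close>

lemma win_reflected_word:
  assumes "xs \<noteq> []" "q \<le> 1"
  shows "1 \<le> p \<Longrightarrow> 2 \<le> o' + p \<Longrightarrow> win (o' # p # reflected_word q p xs) \<longleftrightarrow> adm q 0 xs"
    and "1 \<le> o' \<Longrightarrow> win (o' # 0 # reflected_word q 0 xs) \<longleftrightarrow> adm q 2 xs"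
    and "win (0 # 1 # reflected_word q 1 xs) \<longleftrightarrow> adm q 1 xs"
proof -
  have "(\<forall>o' p. 1 \<le> p \<longrightarrow> 2 \<le> o' + p \<longrightarrow> (win (o' # p # reflected_word q p xs) \<longleftrightarrow> adm q 0 xs)) \<and>
    (\<forall>o'\<ge>1. win (o' # 0 # reflected_word q 0 xs) \<longleftrightarrow> adm q 2 xs) \<and>
    (win (0 # 1 # reflected_word q 1 xs) \<longleftrightarrow> adm q 1 xs)"
    using assms
  proof (induction xs rule: induct_list012)
    case (3 x y zs)
    hence IH: "\<And>o' p. 1 \<le> p \<Longrightarrow> 2 \<le> o' + p \<Longrightarrow>
          win (o' # p # reflected_word q p (y # zs)) \<longleftrightarrow> adm q 0 (y # zs)"
        "\<And>o'. 1 \<le> o' \<Longrightarrow> win (o' # 0 # reflected_word q 0 (y # zs)) \<longleftrightarrow> adm q 2 (y # zs)"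
        "win (0 # 1 # reflected_word q 1 (y # zs)) \<longleftrightarrow> adm q 1 (y # zs)"
      by auto
    have win0: "win (0 # 0 # ws') = False" for ws' by (cases ws') auto
    show ?case
    proof (intro conjI allI impI)
      fix o' p :: nat assume *: "1 \<le> p" "2 \<le> o' + p"
      show "win (o' # p # reflected_word q p (x # y # zs)) \<longleftrightarrow> adm q 0 (x # y # zs)"
        using * IH(2)[of p] IH(1)[of x p] by (cases "x = 0") auto
    next
      fix o' :: nat assume *: "1 \<le> o'"
      show "win (o' # 0 # reflected_word q 0 (x # y # zs)) \<longleftrightarrow> adm q 2 (x # y # zs)"
      proof -
        consider "x = 0" | "x = 1" | "2 \<le> x" by linarith
        thus ?thesis
        proof cases
          case 1 thus ?thesis by (simp add: win0)
        next
          case 2 thus ?thesis using * IH(3) by simp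
        next
          case 3 thus ?thesis using * IH(1)[of x 0] by simp
        qed
      qed
    next
      show "win (0 # 1 # reflected_word q 1 (x # y # zs)) \<longleftrightarrow> adm q 1 (x # y # zs)"
        using IH(1)[of x 1] by auto
    qed
  qed auto
  thus "1 \<le> p \<Longrightarrow> 2 \<le> o' + p \<Longrightarrow> win (o' # p # reflected_word q p xs) \<longleftrightarrow> adm q 0 xs"
    and "1 \<le> o' \<Longrightarrow> win (o' # 0 # reflected_word q 0 xs) \<longleftrightarrow> adm q 2 xs"
    and "win (0 # 1 # reflected_word q 1 xs) \<longleftrightarrow> adm q 1 xs"
    by blast+
qed

text \<open>For an axis between two positions the first entry occurs twice. It must be positive,
  which is the demand of state 1, and two positive entries leave state 0.\<close>

lemma win_doubled:
  assumes "xs \<noteq> []" "q \<le> 1"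
  shows "win (hd (reflected_word q p xs) # reflected_word q (hd (reflected_word q p xs)) xs) \<longleftrightarrow>
    adm q 1 xs"
proof -
  obtain b ys where xs: "xs = b # ys" using assms(1) by (cases xs) auto
  show ?thesis
  proof (cases ys)
    case Nil
    thus ?thesis using assms xs by auto
  next
    case (Cons c bs)
    have "win (0 # 0 # ws) = False" for ws by (cases ws) auto
    thus ?thesis using xs Cons win_reflected_word(1)[of "c # bs" q b b] assms
      by (cases "b = 0") auto
  qed
qed

text \<open>The centre \<open>1 + 2 * f\<close> has equal neighbours. A centre of at least 3 leaves
  no demand; a centre 1 forces the neighbours to be positive, as state 1 does.\<close>

lemma win_odd_centre:
  assumes "xs \<noteq> []" "q = 0"
  shows "win (hd (reflected_word q p xs) # (1 + 2 * f) # reflected_word q (1 + 2 * f) xs) \<longleftrightarrow>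
    (if f = 0 then adm q 1 xs else adm q 0 xs)"
proof (cases "f = 0")
  case False
  thus ?thesis using win_reflected_word(1)[of xs q "1 + 2 * f"] assms by simp
next
  case True
  let ?h = "hd (reflected_word q p xs)"
  show ?thesis
  proof (cases "?h = 0")
    case True
    thus ?thesis using \<open>f = 0\<close> win_reflected_word(3)[of xs q] assms by simp
  next
    case False
    have "adm q 1 xs = adm q 0 xs"
    proof (cases xs)
      case (Cons a ys)
      thus ?thesis using False assms by (cases ys) auto
    qed (use assms in simp)
    thus ?thesis using \<open>f = 0\<close> False win_reflected_word(1)[of xs q 1 ?h] assms by simp
  qed
qed

section \<open>Quasiperiodic functions as words\<close>

lemma int_periodic_mult:
  fixes F :: "int \<Rightarrow> 'a"
  assumes "\<And>j. F (j + p) = F j"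
  shows "F (j + m * p) = F j"
proof -
  have nat: "F (j + int n * p) = F j" for n j
  proof (induction n)
    case (Suc n)
    thus ?case using assms[of "j + int n * p"] by (simp add: algebra_simps)
  qed simp
  show ?thesis
    using nat[of j "nat m"] nat[of "j + m * p" "nat (- m)"] by (cases "0 \<le> m") auto
qed

context core_params
begin

definition q :: nat where
  "q = (if even d then 1 else 0)"

text \<open>The total to which the letters of any quasiperiodic odd \<open>h\<close>
  telescope.\<close>

definition weight :: nat where
  "weight = r + (d + 1) div 2 - c"

definition quasiperiodic_odd :: "(int \<Rightarrow> int) set" where
  "quasiperiodic_odd = {h. (\<forall>j. h (j + int s) = h j - int d) \<and> (\<forall>j. h (int c - j) = - h j)}"

definition drop_at :: "(int \<Rightarrow> int) \<Rightarrow> int \<Rightarrow> int" where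
  "drop_at h j = 1 - h j + h (j - 1)"

text \<open>
  \<open>letter h i\<close> is \<open>drop_at h (i + 1)\<close>, except that entries on an axis of symmetry are
  halved: the last one always (\<open>2 e\<close> or \<open>2 e + 1\<close>), and the first one (\<open>1 + 2 f\<close>) if \<open>c = 1\<close>.
\<close>

definition letter :: "(int \<Rightarrow> int) \<Rightarrow> nat \<Rightarrow> int" where
  "letter h i = (if i = r then int ((d + 1) div 2) + h (int r)
     else if i = 0 then 1 - int c - h 1 else 1 - h (int i + 1) + h (int i))"

definition word_of :: "(int \<Rightarrow> int) \<Rightarrow> nat list" where
  "word_of h = map (\<lambda>i. nat (letter h i)) [0..<Suc r]"

text \<open>For \<open>c = 1\<close> the first letter is the \<open>f\<close> of the centre
  \<open>1 + 2 f\<close>, and the automaton reads only the rest, starting as in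
  \<open>win_odd_centre\<close>.\<close>

definition admissible_code :: "nat list \<Rightarrow> bool" where
  "admissible_code xs \<longleftrightarrow> (if c = 0 \<or> hd xs = 0 then adm q 1 (drop c xs) else adm q 0 (tl xs))"

definition codes :: "nat list set" where
  "codes = {xs. length xs = Suc r \<and> sum_list xs = weight \<and> admissible_code xs}"

lemma c_le_r: "c \<le> r"
  using c_cases s_eq s_pos by auto

lemma int_s: "int s = 2 * int r + 1 - int c"
  using s_eq by simp

lemma weight_int: "int weight = int r + int ((d + 1) div 2) - int c"
  using c_le_r by (simp add: weight_def)

lemma q_le: "q \<le> 1"
  by (simp add: q_def)

lemma d_half: "2 * int ((d + 1) div 2) = int d + 1 - int q"
  by (auto simp: q_def elim!: evenE oddE)

lemma q_0: "c = 1 \<Longrightarrow> q = 0"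
  using odd_d_if by (simp add: q_def)

text \<open>Reduce modulo \<open>s\<close> to \<open>1..s\<close> and reflect what exceeds
  \<open>r + 1\<close>. Here \<open>e = c + 1\<close> serves windows indexed by their centre,
  \<open>e = c + 2\<close> pairs indexed by their right end.\<close>

lemma fold_to_half_period:
  fixes F :: "int \<Rightarrow> 'a"
  assumes per: "\<And>j. F (j + int s) = F j" and refl: "\<And>j. F (int e - j) = F j"
    and e: "e = c + 1 \<or> e = c + 2"
  obtains m where "1 \<le> m" "m \<le> r + 1" "F j = F (int m)"
proof -
  define j' where "j' = (j - 1) mod int s + 1"
  have range: "1 \<le> j'" "j' \<le> int s"
    unfolding j'_def using s_pos pos_mod_bound[of "int s" "j - 1"] pos_mod_sign[of "int s" "j - 1"]
    by linarith+
  have "j = j' + ((j - 1) div int s) * int s" by (simp add: j'_def)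
  hence eq: "F j = F j'" using int_periodic_mult[of F "int s", OF per] by metis
  show thesis
  proof (cases "j' \<le> int r + 1")
    case True
    thus ?thesis using that[of "nat j'"] range eq by simp
  next
    case False
    define m where "m = int e - (j' - int s)"
    have "F m = F j'" unfolding m_def refl using per[of "j' - int s"] by simp
    moreover have "1 \<le> m" "m \<le> int r + 1" using range False e int_s by (auto simp: m_def)
    ultimately show ?thesis using that[of "nat m"] eq by simp
  qed
qed

lemma drop_at_shift: "h \<in> quasiperiodic_odd \<Longrightarrow> drop_at h (j + int s) = drop_at h j"
proof -
  assume "h \<in> quasiperiodic_odd"
  hence "h (j + int s) = h j - int d" "h (j - 1 + int s) = h (j - 1) - int d"
    unfolding quasiperiodic_odd_def by blast+
  thus ?thesis by (simp add: drop_at_def algebra_simps)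
qed

lemma drop_at_reflect: "h \<in> quasiperiodic_odd \<Longrightarrow> drop_at h (int c + 1 - j) = drop_at h j"
proof -
  assume "h \<in> quasiperiodic_odd"
  hence "h (int c - (j - 1)) = - h (j - 1)" "h (int c - j) = - h j"
    unfolding quasiperiodic_odd_def by blast+
  thus ?thesis by (simp add: drop_at_def algebra_simps)
qed

text \<open>\<open>k\<close> consecutive drops sum to \<open>k\<close> minus an increment of
  \<open>h\<close> over \<open>k\<close> steps. Triples are indexed by their centre, hence the shift
  for \<open>k = 3\<close>.\<close>

lemma heights_iff:
  "h \<in> heights \<longleftrightarrow> h \<in> quasiperiodic_odd \<and> (\<forall>j. 0 \<le> drop_at h j) \<and>
     (\<forall>j. 1 \<le> drop_at h (j - 1) + drop_at h j) \<and>
     (\<forall>j. 2 \<le> drop_at h (j - 1) + drop_at h j + drop_at h (j + 1))"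
proof -
  have "(\<forall>j. h j \<le> h (j - 3) + 1) \<longleftrightarrow> (\<forall>j. h (j + 1) \<le> h (j - 2) + 1)"
  proof (intro iffI allI)
    show "h (j + 1) \<le> h (j - 2) + 1" if "\<forall>j. h j \<le> h (j - 3) + 1" for j
      using that[rule_format, of "j + 1"] by (simp add: algebra_simps)
    show "h j \<le> h (j - 3) + 1" if "\<forall>j. h (j + 1) \<le> h (j - 2) + 1" for j
      using that[rule_format, of "j - 1"] by (simp add: algebra_simps)
  qed
  thus ?thesis
    unfolding heights_def quasiperiodic_odd_def drop_at_def by (simp add: algebra_simps) blast
qed

lemma h_0: "h \<in> quasiperiodic_odd \<Longrightarrow> c = 0 \<Longrightarrow> h 0 = 0"
proof -
  assume "h \<in> quasiperiodic_odd" "c = 0"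
  hence "h (int c - 0) = - h 0" unfolding quasiperiodic_odd_def by blast
  thus ?thesis using \<open>c = 0\<close> by simp
qed

lemma drop_at_letter:
  assumes "h \<in> quasiperiodic_odd" "1 \<le> m" "m \<le> r" "c = 0 \<or> m \<noteq> 1"
  shows "drop_at h (int m) = letter h (m - 1)"
  using assms h_0[OF assms(1)] by (cases m) (auto simp: drop_at_def letter_def add.commute)

lemma drop_at_1:
  assumes "h \<in> quasiperiodic_odd" "c = 1"
  shows "drop_at h 1 = 1 + 2 * letter h 0"
proof -
  have "h (int c - 1) = - h 1" using assms unfolding quasiperiodic_odd_def by blast
  moreover have "letter h 0 = - h 1" unfolding letter_def using assms(2) c_le_r by simp
  ultimately show ?thesis unfolding drop_at_def using assms(2) by simp
qed

text \<open>Reflection followed by a shift by \<open>s\<close> fixes the axis \<open>r + 1\<close>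
  and expresses \<open>h (r + 1)\<close> by \<open>h r\<close>; the parity of \<open>d\<close>
  decides that of the entry.\<close>

lemma drop_at_last:
  assumes "h \<in> quasiperiodic_odd"
  shows "drop_at h (int r + 1) = 2 * letter h r + int q"
proof -
  have "h (int c - int r + int s) = h (int c - int r) - int d" "h (int c - int r) = - h (int r)"
    using assms unfolding quasiperiodic_odd_def by blast+
  hence "h (int r + 1) = - h (int r) - int d" by (simp add: int_s)
  thus ?thesis using d_half by (simp add: drop_at_def letter_def)
qed

lemma drop_at_ends:
  assumes "h \<in> quasiperiodic_odd"
  shows "drop_at h 0 = drop_at h (int c + 1)" "drop_at h (int r + 2) = drop_at h (int r)"
proof -
  show "drop_at h 0 = drop_at h (int c + 1)" using drop_at_reflect[OF assms, of 0] by simp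
  have "drop_at h (int c + 1 - (int r + 2) + int s) = drop_at h (int r + 2)"
    using drop_at_shift[OF assms] drop_at_reflect[OF assms] by metis
  thus "drop_at h (int r + 2) = drop_at h (int r)" by (simp add: int_s)
qed

section \<open>Reduction of the inequalities to half a period\<close>

lemma drop_at_nonneg_iff:
  assumes h: "h \<in> quasiperiodic_odd"
  shows "(\<forall>j. 0 \<le> drop_at h j) \<longleftrightarrow> (\<forall>i\<le>r. 0 \<le> letter h i)"
proof
  assume *: "\<forall>j. 0 \<le> drop_at h j"
  show "\<forall>i\<le>r. 0 \<le> letter h i"
  proof (intro allI impI)
    fix i assume "i \<le> r"
    consider "i = r" | "i < r" "c = 1" "i = 0" | "i < r" "c = 0 \<or> i \<noteq> 0"
      using \<open>i \<le> r\<close> c_cases by linarith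
    thus "0 \<le> letter h i"
    proof cases
      case 1
      thus ?thesis using drop_at_last[OF h] *[rule_format, of "int r + 1"] q_le by simp
    next
      case 2
      thus ?thesis using drop_at_1[OF h] *[rule_format, of 1] by simp
    next
      case 3
      thus ?thesis using drop_at_letter[OF h, of "Suc i"] *[rule_format, of "int (Suc i)"] by simp
    qed
  qed
next
  assume *: "\<forall>i\<le>r. 0 \<le> letter h i"
  show "\<forall>j. 0 \<le> drop_at h j"
  proof
    fix j
    obtain m where m: "1 \<le> m" "m \<le> r + 1" "drop_at h j = drop_at h (int m)"
      using fold_to_half_period[of "drop_at h" "c + 1" j] drop_at_shift[OF h] drop_at_reflect[OF h]
      by (auto simp: add.commute)
    consider "m = r + 1" | "m \<le> r" "c = 1" "m = 1" | "m \<le> r" "c = 0 \<or> m \<noteq> 1"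
      using m c_cases by linarith
    thus "0 \<le> drop_at h j"
    proof cases
      case 1
      thus ?thesis using drop_at_last[OF h] * m by (simp add: add.commute)
    next
      case 2
      thus ?thesis using drop_at_1[OF h] * m by simp
    next
      case 3
      thus ?thesis using drop_at_letter[OF h, of m] * m by simp
    qed
  qed
qed

text \<open>Positions \<open>1..r + 1\<close> with one neighbour on either side, so that every
  window centred there is complete.\<close>

definition half_period :: "(int \<Rightarrow> int) \<Rightarrow> nat list" where
  "half_period h = map (\<lambda>i. nat (drop_at h (int i))) [0..<r + 3]"

text \<open>The axis \<open>1 / 2\<close> repeats the first entry at position 0, the axis
  \<open>r + 1\<close> repeats entry \<open>r\<close> at position \<open>r + 2\<close>.\<close>

lemma half_period_eq_even:
  assumes h: "h \<in> quasiperiodic_odd" and nonneg: "\<forall>i\<le>r. 0 \<le> letter h i" and c: "c = 0"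
  shows "half_period h = hd (reflected_word q 0 (word_of h)) #
    reflected_word q (hd (reflected_word q 0 (word_of h))) (word_of h)"
proof -
  let ?xs = "word_of h"
  define p where "p = hd (reflected_word q 0 ?xs)"
  have ne: "?xs \<noteq> []" and len: "length ?xs = Suc r" by (auto simp: word_of_def)
  have nth: "?xs ! i = nat (letter h i)" if "i \<le> r" for i
    using that by (simp add: word_of_def nth_append del: upt_Suc)
  have last: "last ?xs = nat (letter h r)" by (simp add: word_of_def)
  have b_last: "nat (drop_at h (int r + 1)) = 2 * nat (letter h r) + q"
    using drop_at_last[OF h] nonneg by (simp add: nat_add_distrib nat_mult_distrib)
  have b: "nat (drop_at h (int (Suc i))) = ?xs ! i" if "i < r" for i
    using drop_at_letter[OF h, of "Suc i"] that c nth[of i] by simp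
  have hd: "p = reflected_word q 0 ?xs ! 0"
    using length_reflected_word[OF ne, of q 0] by (cases "reflected_word q 0 ?xs") (auto simp: p_def)
  have "drop_at h 0 = drop_at h 1" using drop_at_ends(1)[OF h] c by simp
  hence p: "nat (drop_at h 0) = p"
    unfolding hd using reflected_word_nth[OF ne, of 0 q 0] b[of 0] b_last last len
    by (cases "r = 0") auto
  show ?thesis unfolding p_def[symmetric]
  proof (rule nth_equalityI)
    show "length (half_period h) = length (p # reflected_word q p ?xs)"
      using length_reflected_word[OF ne] len by (simp add: half_period_def)
    fix i assume "i < length (half_period h)"
    hence i: "i < r + 3" by (simp add: half_period_def)
    hence lhs: "half_period h ! i = nat (drop_at h (int i))"
      by (simp add: half_period_def del: upt_Suc)
    consider "i = 0" | k where "i = Suc k" "k < r" | "i = Suc r" | "i = r + 2" "r = 0"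
      | "i = r + 2" "r \<noteq> 0"
    proof -
      have "i = 0 \<or> (i = Suc (i - 1) \<and> i - 1 < r) \<or> i = Suc r \<or> (i = r + 2 \<and> r = 0) \<or> (i = r + 2 \<and> r \<noteq> 0)"
        using i by arith
      thus thesis using that by blast
    qed
    thus "half_period h ! i = (p # reflected_word q p ?xs) ! i"
    proof cases
      case 1 thus ?thesis using lhs p by simp
    next
      case (2 k) thus ?thesis unfolding lhs using reflected_word_nth[OF ne, of k q p] b len by simp
    next
      case 3 thus ?thesis unfolding lhs using reflected_word_nth[OF ne, of r q p] b_last len last
        by (simp add: add.commute)
    next
      case 4
      hence "nat (drop_at h 2) = p" using drop_at_ends(2)[OF h] p by simp
      thus ?thesis unfolding lhs using 4 reflected_word_nth[OF ne, of 1 q p] len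
        by (simp add: numeral_2_eq_2)
    next
      case 5
      have "nat (drop_at h (int r)) = ?xs ! (r - 1)" using b[of "r - 1"] 5 by simp
      thus ?thesis unfolding lhs using 5 reflected_word_nth[OF ne, of "Suc r" q p] len drop_at_ends(2)[OF h]
        by (simp add: add.commute)
    qed
  qed
qed

text \<open>The first axis now passes through position 1, with entry
  \<open>1 + 2 * hd (word_of h)\<close>, and positions 0 and 2 agree.\<close>

lemma half_period_eq_odd:
  assumes h: "h \<in> quasiperiodic_odd" and nonneg: "\<forall>i\<le>r. 0 \<le> letter h i" and c: "c = 1"
  shows "half_period h = hd (reflected_word q 0 (tl (word_of h))) # (1 + 2 * hd (word_of h)) #
    reflected_word q (1 + 2 * hd (word_of h)) (tl (word_of h))"
proof -
  let ?xs = "word_of h"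
  let ?ys = "tl ?xs"
  define p where "p = 1 + 2 * hd ?xs"
  have r: "1 \<le> r" using c_le_r c by simp
  have len: "length ?xs = Suc r" by (auto simp: word_of_def)
  have len': "length ?ys = r" and ne: "?ys \<noteq> []" using len r by (auto simp flip: length_0_conv)
  have nth: "?xs ! i = nat (letter h i)" if "i \<le> r" for i
    using that by (simp add: word_of_def nth_append del: upt_Suc)
  have nth': "?ys ! i = nat (letter h (Suc i))" if "i < r" for i
    using that nth[of "Suc i"] len' by (simp add: nth_tl)
  have hd_xs: "hd ?xs = nat (letter h 0)" using nth[of 0] len by (cases ?xs) auto
  have last: "last ?ys = nat (letter h r)" using nth'[of "r - 1"] r ne len' by (simp add: last_conv_nth)
  have b_last: "nat (drop_at h (int r + 1)) = 2 * nat (letter h r) + q"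
    using drop_at_last[OF h] nonneg by (simp add: nat_add_distrib nat_mult_distrib)
  have b: "nat (drop_at h (int (i + 2))) = ?ys ! i" if "Suc i < r" for i
    using drop_at_letter[OF h, of "i + 2"] that nth'[of i] by simp
  have p: "nat (drop_at h 1) = p"
    using drop_at_1[OF h c] hd_xs nonneg by (simp add: p_def nat_add_distrib nat_mult_distrib)
  have hd: "hd (reflected_word q 0 ?ys) = reflected_word q 0 ?ys ! 0"
    using length_reflected_word[OF ne, of q 0] by (cases "reflected_word q 0 ?ys") auto
  have b0: "nat (drop_at h 0) = hd (reflected_word q 0 ?ys)"
    unfolding drop_at_ends(1)[OF h] hd using reflected_word_nth[OF ne, of 0 q 0] b[of 0] b_last last len' c r
    by (cases "r = 1") auto
  show ?thesis unfolding p_def[symmetric]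
  proof (rule nth_equalityI)
    show "length (half_period h) = length (hd (reflected_word q 0 ?ys) # p # reflected_word q p ?ys)"
      using length_reflected_word[OF ne] len' r by (simp add: half_period_def)
    fix i assume "i < length (half_period h)"
    hence i: "i < r + 3" by (simp add: half_period_def)
    hence lhs: "half_period h ! i = nat (drop_at h (int i))"
      by (simp add: half_period_def del: upt_Suc)
    consider "i = 0" | "i = 1" | k where "i = k + 2" "Suc k < r" | "i = Suc r" | "i = r + 2" "r = 1"
      | "i = r + 2" "1 < r"
    proof -
      have "i = 0 \<or> i = 1 \<or> (i = (i - 2) + 2 \<and> Suc (i - 2) < r) \<or> i = Suc r \<or> (i = r + 2 \<and> r = 1) \<or> (i = r + 2 \<and> 1 < r)"
        using i r by arith
      thus thesis using that by blast
    qed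
    thus "half_period h ! i = (hd (reflected_word q 0 ?ys) # p # reflected_word q p ?ys) ! i"
    proof cases
      case 1 thus ?thesis using lhs b0 by simp
    next
      case 2 thus ?thesis using lhs p by simp
    next
      case (3 k) thus ?thesis unfolding lhs using reflected_word_nth[OF ne, of k q p] b[of k] len' by simp
    next
      case 4
      have "Suc r = Suc (Suc (r - 1))" using r by simp
      thus ?thesis unfolding lhs using 4 reflected_word_nth[OF ne, of "r - 1" q p] b_last len' last r
        by (simp add: add.commute nth_Cons')
    next
      case 5
      hence "nat (drop_at h 3) = p" using drop_at_ends(2)[OF h] p by simp
      thus ?thesis unfolding lhs using 5 reflected_word_nth[OF ne, of 1 q p] len'
        by (simp add: numeral_3_eq_3)
    next
      case 6
      have "int r = int (r - 2 + 2)" using 6 by simp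
      hence "nat (drop_at h (int r)) = ?ys ! (r - 2)" using b[of "r - 2"] 6 by simp
      thus ?thesis unfolding lhs using 6 reflected_word_nth[OF ne, of r q p] len' drop_at_ends(2)[OF h]
        by (simp add: add.commute)
    qed
  qed
qed

lemma win_half_period_iff:
  assumes h: "h \<in> quasiperiodic_odd" and nonneg: "\<forall>j. 0 \<le> drop_at h j"
  shows "win (half_period h) \<longleftrightarrow>
     (\<forall>j. 1 \<le> drop_at h (j - 1) + drop_at h j) \<and>
     (\<forall>j. 2 \<le> drop_at h (j - 1) + drop_at h j + drop_at h (j + 1))"
proof -
  have len: "length (half_period h) = r + 3" by (simp add: half_period_def)
  have nth: "int (half_period h ! i) = drop_at h (int i)" if "i < r + 3" for i
    using that nonneg by (simp add: half_period_def del: upt_Suc)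
  have pair_nth: "1 \<le> half_period h ! i + half_period h ! Suc i \<longleftrightarrow>
      1 \<le> drop_at h (int (Suc i) - 1) + drop_at h (int (Suc i))" if "Suc i < r + 3" for i
    using nth[of i] nth[of "Suc i"] that by auto
  have triple_nth: "2 \<le> half_period h ! i + half_period h ! Suc i + half_period h ! Suc (Suc i) \<longleftrightarrow>
      2 \<le> drop_at h (int (Suc i) - 1) + drop_at h (int (Suc i)) + drop_at h (int (Suc i) + 1)"
    if "Suc (Suc i) < r + 3" for i
    using nth[of i] nth[of "Suc i"] nth[of "Suc (Suc i)"] that by (auto simp: algebra_simps)
  show ?thesis
  proof
    assume win: "win (half_period h)"
    show "(\<forall>j. 1 \<le> drop_at h (j - 1) + drop_at h j) \<and>
        (\<forall>j. 2 \<le> drop_at h (j - 1) + drop_at h j + drop_at h (j + 1))"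
    proof (intro conjI allI)
      fix j
      let ?F = "\<lambda>j. drop_at h (j - 1) + drop_at h j"
      have "?F (j + int s) = ?F j" for j
        using drop_at_shift[OF h, of j] drop_at_shift[OF h, of "j - 1"] by (simp add: algebra_simps)
      moreover have "?F (int (c + 2) - j) = ?F j" for j
        using drop_at_reflect[OF h, of j] drop_at_reflect[OF h, of "j - 1"] by (simp add: algebra_simps)
      ultimately obtain m where m: "1 \<le> m" "m \<le> r + 1" "?F j = ?F (int m)"
        using fold_to_half_period[of ?F "c + 2" j] by blast
      have "1 \<le> ?F (int m)"
        using win m pair_nth[of "m - 1"] unfolding win_iff len by (cases m) auto
      thus "1 \<le> ?F j" using m by simp
    next
      fix j
      let ?F = "\<lambda>j. drop_at h (j - 1) + drop_at h j + drop_at h (j + 1)"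
      have "?F (j + int s) = ?F j" for j
        using drop_at_shift[OF h, of j] drop_at_shift[OF h, of "j - 1"] drop_at_shift[OF h, of "j + 1"]
        by (simp add: algebra_simps)
      moreover have "?F (int (c + 1) - j) = ?F j" for j
        using drop_at_reflect[OF h, of j] drop_at_reflect[OF h, of "j - 1"] drop_at_reflect[OF h, of "j + 1"]
        by (simp add: algebra_simps)
      ultimately obtain m where m: "1 \<le> m" "m \<le> r + 1" "?F j = ?F (int m)"
        using fold_to_half_period[of ?F "c + 1" j] by blast
      have "2 \<le> ?F (int m)"
        using win m triple_nth[of "m - 1"] unfolding win_iff len by (cases m) auto
      thus "2 \<le> ?F j" using m by simp
    qed
  next
    assume "(\<forall>j. 1 \<le> drop_at h (j - 1) + drop_at h j) \<and>
        (\<forall>j. 2 \<le> drop_at h (j - 1) + drop_at h j + drop_at h (j + 1))"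
    thus "win (half_period h)" unfolding win_iff len using pair_nth triple_nth by blast
  qed
qed

lemma heights_iff_admissible:
  assumes h: "h \<in> quasiperiodic_odd" and nonneg: "\<forall>i\<le>r. 0 \<le> letter h i"
  shows "h \<in> heights \<longleftrightarrow> admissible_code (word_of h)"
proof -
  have len: "length (word_of h) = Suc r" by (simp add: word_of_def)
  have "h \<in> heights \<longleftrightarrow> win (half_period h)"
    using heights_iff win_half_period_iff h nonneg drop_at_nonneg_iff[OF h] by blast
  also have "\<dots> \<longleftrightarrow> admissible_code (word_of h)"
    using c_cases
  proof
    assume c: "c = 0"
    have "word_of h \<noteq> []" using len by auto
    moreover have "admissible_code (word_of h) \<longleftrightarrow> adm q 1 (word_of h)"
      unfolding admissible_code_def using c by simp
    ultimately show ?thesis unfolding half_period_eq_even[OF h nonneg c]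
      using win_doubled[OF _ q_le] by simp
  next
    assume c: "c = 1"
    have "tl (word_of h) \<noteq> []" using len c c_le_r by (simp flip: length_0_conv)
    moreover have "admissible_code (word_of h) \<longleftrightarrow>
        (if hd (word_of h) = 0 then adm q 1 (tl (word_of h)) else adm q 0 (tl (word_of h)))"
      unfolding admissible_code_def using c by (simp add: drop_Suc)
    ultimately show ?thesis unfolding half_period_eq_odd[OF h nonneg c]
      using win_odd_centre[OF _ q_0[OF c]] by simp
  qed
  finally show ?thesis .
qed

section \<open>Bijection between height functions and codes\<close>

lemma sum_letters:
  assumes h: "h \<in> quasiperiodic_odd" and "n \<le> r" "c \<le> n"
  shows "(\<Sum>i<n. letter h i) = int n - int c - h (int n)"
proof (cases "n = 0")
  case True
  thus ?thesis using assms(3) h_0[OF h] by simp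
next
  case False
  hence "1 \<le> n" by simp
  thus ?thesis using assms(2)
  proof (induction n rule: nat_induct_at_least)
    case base
    thus ?case by (simp add: letter_def)
  next
    case (Suc n)
    thus ?case by (simp add: letter_def add.commute)
  qed
qed

lemma sum_word_of:
  assumes h: "h \<in> quasiperiodic_odd" and nonneg: "\<forall>i\<le>r. 0 \<le> letter h i"
  shows "sum_list (word_of h) = weight"
proof -
  have "int (sum_list (word_of h)) = (\<Sum>i<Suc r. letter h i)"
    unfolding word_of_def by (simp add: interv_sum_list_conv_sum_set_nat nonneg atLeast0LessThan del: upt_Suc)
  also have "\<dots> = int weight" using sum_letters[OF h, of r] c_le_r by (simp add: letter_def weight_int)
  finally show ?thesis by simp
qed

lemma heights_quasi: "h \<in> heights \<Longrightarrow> h \<in> quasiperiodic_odd"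
  by (simp add: heights_iff)

lemma heights_nonneg: "h \<in> heights \<Longrightarrow> \<forall>i\<le>r. 0 \<le> letter h i"
  using drop_at_nonneg_iff heights_iff by blast

lemma word_of_in_codes:
  assumes "h \<in> heights"
  shows "word_of h \<in> codes"
proof -
  note h = heights_quasi[OF assms] heights_nonneg[OF assms]
  have "length (word_of h) = Suc r" by (simp add: word_of_def)
  thus ?thesis
    using sum_word_of[OF h] heights_iff_admissible[OF h] assms unfolding codes_def by blast
qed

lemma inj_on_word_of: "inj_on word_of heights"
proof (rule inj_onI)
  fix h h' assume h: "h \<in> heights" and h': "h' \<in> heights" and eq: "word_of h = word_of h'"
  have letter: "letter h i = letter h' i" if "i \<le> r" for i
  proof -
    have "word_of h ! i = word_of h' ! i" using eq by simp
    hence "nat (letter h i) = nat (letter h' i)"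
      using that by (simp add: word_of_def del: upt_Suc)
    thus ?thesis
      using heights_nonneg[OF h, rule_format, OF that] heights_nonneg[OF h', rule_format, OF that]
      by simp
  qed
  have half: "h (int n) = h' (int n)" if "n \<le> r" "c \<le> n" for n
  proof -
    have "(\<Sum>i<n. letter h i) = (\<Sum>i<n. letter h' i)" using that letter by (intro sum.cong) auto
    thus ?thesis using sum_letters[OF heights_quasi[OF h] that] sum_letters[OF heights_quasi[OF h'] that]
      by simp
  qed
  have reflect: "h (int c - j) = - h j" "h' (int c - j) = - h' j" for j
    using h h' by (auto simp: heights_def)
  show "h = h'"
  proof
    fix j
    define i where "i = j mod int s"
    define m where "m = j div int s"
    have j: "j = i + m * int s" by (simp add: i_def m_def)
    have i: "0 \<le> i" "i < int s" using s_pos by (auto simp: i_def)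
    have "h i = h' i"
    proof -
      \<comment> \<open>The letters determine \<open>h\<close> on \<open>c..r\<close>; reflection
        covers 0 if \<open>c = 1\<close>, and reflection with a shift covers the residues above
        \<open>r\<close>.\<close>
      consider "i \<le> int r" "int c \<le> i" | "i < int c" | "int r < i" by linarith
      thus ?thesis
      proof cases
        case 1 thus ?thesis using half[of "nat i"] by simp
      next
        case 2
        hence "i = 0" "c = 1" using i c_cases by auto
        thus ?thesis using half[of 1] reflect[of 1] c_le_r by simp
      next
        case 3
        define k where "k = nat (int c + int s - i)"
        have k: "int k = int c + int s - i" "k \<le> r" "c \<le> k" using 3 i int_s by (auto simp: k_def)
        have "i = (int c - int k) + 1 * int s" using k by simp
        hence "h i = - h (int k) - int d" "h' i = - h' (int k) - int d"
          using height_shift[OF h, of "int c - int k" 1] height_shift[OF h', of "int c - int k" 1] reflect by simp_all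
        thus ?thesis using half[OF k(2,3)] by simp
      qed
    qed
    thus "h j = h' j" unfolding j height_shift[OF h] height_shift[OF h'] by simp
  qed
qed

lemma word_of_surj:
  assumes xs: "xs \<in> codes"
  obtains h where "h \<in> heights" "word_of h = xs"
proof -
  have len: "length xs = Suc r" and sum: "sum_list xs = weight" and adm: "admissible_code xs"
    using xs by (auto simp: codes_def)
  define g where "g n = int n - int c - (\<Sum>i<n. int (xs ! i))" for n
  \<comment> \<open>\<open>i\<close> is the representative of \<open>j\<close> modulo
    \<open>s\<close> in \<open>-(r - c)..r\<close>, an interval of length \<open>s\<close> symmetric
    about \<open>c / 2\<close>. Its right half takes the partial sums \<open>g\<close>, its left
    half their negated reflection.\<close>
  define h where "h j = (let m = (j + int (r - c)) div int s; i = (j + int (r - c)) mod int s - int (r - c)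
      in (if int c \<le> i then g (nat i) else - g (nat (int c - i))) - m * int d)" for j
  have s_minus: "int s - 1 = int r + int (r - c)" using int_s c_le_r by simp
  have shift: "h (j + int s) = h j - int d" for j
  proof -
    have "j + int s + int (r - c) = (j + int (r - c)) + int s" by simp
    thus ?thesis unfolding h_def Let_def using s_pos
      by (simp only: div_add_self2 mod_add_self2) (simp add: algebra_simps)
  qed
  have reflect: "h (int c - j) = - h j" for j
  proof -
    define m where "m = (j + int (r - c)) div int s"
    define \<rho> where "\<rho> = (j + int (r - c)) mod int s"
    have \<rho>: "0 \<le> \<rho>" "\<rho> < int s" using s_pos by (auto simp: \<rho>_def)
    have "j + int (r - c) = \<rho> + m * int s" by (simp add: m_def \<rho>_def)
    hence "int c - j + int (r - c) = (int s - 1 - \<rho>) + (- m) * int s"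
      using s_minus c_le_r by (simp add: algebra_simps)
    hence e: "(int c - j + int (r - c)) div int s = - m" "(int c - j + int (r - c)) mod int s = int s - 1 - \<rho>"
      using \<rho> by (simp_all only: div_mult_self1 mod_mult_self1) (use \<rho> s_pos in simp_all)
    define i where "i = \<rho> - int (r - c)"
    have i: "int s - 1 - \<rho> - int (r - c) = int c - i"
      using s_minus c_le_r by (simp add: i_def)
    have "h (int c - j) = (if int c \<le> int c - i then g (nat (int c - i))
        else - g (nat (int c - (int c - i)))) - (- m) * int d"
      unfolding h_def Let_def e i ..
    moreover have "h j = (if int c \<le> i then g (nat i) else - g (nat (int c - i))) - m * int d"
      by (simp add: h_def Let_def i_def m_def \<rho>_def)
    \<comment> \<open>For \<open>c = 0\<close> the reflection fixes 0, where oddness forces the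
      value 0.\<close>
    moreover have "g 0 = 0" if "c = 0" using that by (simp add: g_def)
    ultimately show ?thesis using c_cases by auto
  qed
  have quasi: "h \<in> quasiperiodic_odd" using shift reflect by (simp add: quasiperiodic_odd_def)
  have h_half: "h (int n) = g n" if "n \<le> r" "c \<le> n" for n
  proof -
    have "int n + int (r - c) < int s" using that s_minus by simp
    thus ?thesis using that by (simp add: h_def)
  qed
  have letter: "letter h i = int (xs ! i)" if i: "i \<le> r" for i
  proof -
    consider "i = r" | "i = 0" "i < r" | "0 < i" "i < r" using i by linarith
    thus ?thesis
    proof cases
      case 1
      have "int (sum_list xs) = (\<Sum>i<Suc r. int (xs ! i))"
        unfolding sum_list_sum_nth len by (simp add: atLeast0LessThan)
      thus ?thesis using 1 h_half[of r] c_le_r sum by (simp add: letter_def g_def weight_int)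
    next
      case 2
      thus ?thesis using h_half[of 1] c_le by (simp add: letter_def g_def)
    next
      case 3
      thus ?thesis using h_half[of i] h_half[of "Suc i"] c_le
        by (simp add: letter_def g_def add.commute)
    qed
  qed
  have word: "word_of h = xs"
    by (rule nth_equalityI) (auto simp: word_of_def len letter simp del: upt_Suc)
  have "h \<in> heights"
    using heights_iff_admissible[OF quasi] letter adm word by simp
  thus thesis using word by (rule that)
qed

lemma bij_betw_word_of: "bij_betw word_of heights codes"
  unfolding bij_betw_def
proof (intro conjI equalityI subsetI inj_on_word_of)
  show "xs \<in> codes" if "xs \<in> word_of ` heights" for xs
    using that word_of_in_codes by blast
  show "xs \<in> word_of ` heights" if "xs \<in> codes" for xs
    using word_of_surj[OF that] by blast
qed

lemma codes_even: "c = 0 \<Longrightarrow> codes = words q (Suc 0) r weight"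
  unfolding codes_def words_def admissible_code_def by simp

text \<open>A zero first letter leaves a word from state 1. A positive one leaves state 0, exactly
  as in a word read from state 1 as a whole.\<close>

lemma codes_odd:
  assumes c: "c = 1"
  shows "codes = (#) 0 ` words q (Suc 0) (r - 1) weight \<union> words q (Suc 0) r weight"
proof -
  obtain k where k: "r = Suc k" using c c_le_r by (cases r) auto
  have adm: "admissible_code (x # ys) \<longleftrightarrow> (if x = 0 then adm q 1 ys else adm q 0 ys)" for x ys
    unfolding admissible_code_def using c by simp
  show ?thesis
  proof (rule set_eqI)
    fix xs
    show "xs \<in> codes \<longleftrightarrow> xs \<in> (#) 0 ` words q (Suc 0) (r - 1) weight \<union> words q (Suc 0) r weight"
    proof (cases xs)
      case Nil
      thus ?thesis by (auto simp: codes_def words_def)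
    next
      case (Cons x ys)
      have "x # ys \<in> codes \<longleftrightarrow> length ys = r \<and> x + sum_list ys = weight \<and>
          (if x = 0 then adm q 1 ys else adm q 0 ys)"
        unfolding codes_def mem_Collect_eq adm by simp
      moreover have "x # ys \<in> (#) 0 ` words q (Suc 0) (r - 1) weight \<longleftrightarrow>
          x = 0 \<and> length ys = r \<and> sum_list ys = weight \<and> adm q 1 ys"
        unfolding words_def using k by auto
      moreover have "x # ys \<in> words q (Suc 0) r weight \<longleftrightarrow>
          length ys = r \<and> x + sum_list ys = weight \<and> x \<noteq> 0 \<and> adm q 0 ys"
        unfolding words_def k by (cases ys) auto
      ultimately show ?thesis unfolding Cons by auto
    qed
  qed
qed

lemma finite_codes: "finite codes"
  using c_cases
proof
  show "c = 0 \<Longrightarrow> finite codes" by (subst codes_even) (simp_all add: finite_words)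
  show "c = 1 \<Longrightarrow> finite codes" by (subst codes_odd) (simp_all add: finite_words)
qed

lemma card_codes_odd:
  assumes c: "c = 1"
  shows "card codes = card (words q (Suc 0) (r - 1) weight) + card (words q (Suc 0) r weight)"
proof -
  obtain k where k: "r = Suc k" using c c_le_r by (cases r) auto
  have "(#) 0 ` words q (Suc 0) (r - 1) weight \<inter> words q (Suc 0) r weight = {}"
    unfolding k by (auto simp: Cons_in_words_iff)
  thus ?thesis unfolding codes_odd[OF c]
    by (subst card_Un_disjoint) (auto simp: finite_words card_image)
qed

lemma bij_betw_cores_codes:
  "\<exists>f. bij_betw f (self_conjugate_core_partitions moduli) codes"
proof -
  have "bij_betw (\<lambda>p. range (beta p)) (self_conjugate_core_partitions moduli) (symmetric_closed_sets moduli)"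
    by (rule bij_betw_range_beta) (use s_pos in auto)
  moreover have "bij_betw (inv_into heights set_of) (symmetric_closed_sets moduli) heights"
    by (rule bij_betw_inv_into[OF bij_betw_set_of])
  ultimately show ?thesis using bij_betw_trans[OF bij_betw_trans bij_betw_word_of] by blast
qed

end

section \<open>Assembly and evaluation of the counts\<close>

theorem theorem3p4:
  fixes s d :: nat
  assumes "0 < s" and "0 < d" and "coprime s d"
  shows "finite (self_conjugate_core_partitions [s, s + d, s + 2 * d, s + 3 * d]) \<and>
    (even d \<longrightarrow>
      card (self_conjugate_core_partitions [s, s + d, s + 2 * d, s + 3 * d]) =
      (\<Sum>i = 0..s div 4.
        (((s + d - 1) div 2 - i) choose ((s - 1) div 2 - 2 * i)) *
        (((s + d - 1) div 2 - i) choose i))) \<and>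
    (odd d \<longrightarrow>
      card (self_conjugate_core_partitions [s, s + d, s + 2 * d, s + 3 * d]) =
      (\<Sum>i = 0..s div 2.
        (((s + d - 1) div 2 - i div 2) choose (s div 2 - i)) *
        (((s + d) div 2 - (i + 1) div 2) choose (i div 2))))"
proof -
  define r where "r = s div 2"
  define c where "c = (if even s then 1 else 0 :: nat)"
  interpret core_params s d r c
  proof
    show "s + c = 2 * r + 1" by (auto simp: r_def c_def elim!: evenE oddE)
    show "odd d" if "c = 1"
    proof -
      have "even s" using that by (simp add: c_def split: if_splits)
      thus ?thesis using coprime_common_divisor[OF assms(3), of 2] by auto
    qed
    show "c \<le> 1" by (simp add: c_def)
  qed (rule assms)+
  obtain f where f: "bij_betw f (self_conjugate_core_partitions moduli) codes"
    using bij_betw_cores_codes by blast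
  have finite: "finite (self_conjugate_core_partitions moduli)"
    using bij_betw_finite[OF f] finite_codes by blast
  have card: "card (self_conjugate_core_partitions moduli) = card codes"
    by (rule bij_betw_same_card[OF f])
  have even_case: "card codes = (\<Sum>i = 0..s div 4.
        (((s + d - 1) div 2 - i) choose ((s - 1) div 2 - 2 * i)) *
        (((s + d - 1) div 2 - i) choose i))" if "even d"
  proof -
    \<comment> \<open>An even \<open>d\<close> forces an odd \<open>s\<close>, by
      coprimality.\<close>
    have c: "c = 0" and q: "q = Suc 0"
      using that odd_d_if c_cases by (auto simp: q_def)
    have s: "s = 2 * r + 1" using s_eq c by simp
    have args: "(s + d - 1) div 2 = weight" "(s - 1) div 2 = r" "s div 4 = r div 2"
      using that s c unfolding weight_def by (auto elim!: evenE)
    show ?thesis unfolding args binom_sum_as_sum codes_even[OF c] q card_words_full ..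
  qed
  have odd_case: "card codes = (\<Sum>i = 0..s div 2.
        (((s + d - 1) div 2 - i div 2) choose (s div 2 - i)) *
        (((s + d) div 2 - (i + 1) div 2) choose (i div 2)))" if "odd d"
  proof -
    have q: "q = 0" using that by (simp add: q_def)
    obtain m where m: "d = 2 * m + 1" using \<open>odd d\<close> by (rule oddE)
    show ?thesis using c_cases
    proof
      assume c: "c = 0"
      hence s: "s = 2 * r + 1" using s_eq by simp
      \<comment> \<open>\<open>s + d\<close> is even here, so the two floors differ by one; for even
        \<open>s\<close> they coincide.\<close>
      have args: "(s + d - 1) div 2 = weight - 1" "(s + d) div 2 = weight" "s div 2 = r" and "r < weight"
        using s m c unfolding weight_def by auto
      show ?thesis unfolding args card_words_half_as_sum[OF \<open>r < weight\<close>] codes_even[OF c] q ..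
    next
      assume c: "c = 1"
      hence s: "s = 2 * r" using s_eq by simp
      have args: "(s + d - 1) div 2 = weight" "(s + d) div 2 = weight" "s div 2 = r"
        and r: "0 < r" "r \<le> weight"
        using s m c s_pos unfolding weight_def by auto
      show ?thesis unfolding args card_words_two_ends_as_sum[OF r] card_codes_odd[OF c] q ..
    qed
  qed
  show ?thesis using finite card even_case odd_case by simp
qed

end
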